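(* Let $n\ge1$. For $\underline{k}$ in either $\mathbb{Z}^n$ or $\overline{\mathbb{N}}^n$, let $$f(\underline{k}):=(k_1,\ k_1+k_2,\ k_1+k_2+k_3,\ \dots,\ k_1+\dots+k_n).$$ Let $\mathfrak{F}_n$ (Sheu's groupoid) and $\mathcal{F}$ be the topological groupoids defined in the context. Then the map $$\mathfrak{F}_n^1\longrightarrow\mathcal{F}^1,\qquad (k_0,\underline{k},[\underline{m}])\longmapsto\big(k_0,f(\underline{k}),f(\underline{m})\big),$$ is an isomorphism of topological groupoids.
   Context: Conventions. $\mathbb{N}=\{0,1,2,\dots\}$; $\overline{\mathbb{N}}=\mathbb{N}\cup\{+\infty\}$ is its one-point compactification; $\overline{\mathbb{Z}}=\mathbb{Z}\cup\{+\infty\}$ is the one-point compactification of $\mathbb{Z}$; $k+\infty:=+\infty$ for $k\in\mathbb{Z}$. In a groupoid, a product $fg$ is defined if the target of $f$ equals the source of $g$. An isomorphism of topological groupoids is an isomorphism of groupoids that is a homeomorphism on morphisms and on objects. $\mathcal{H}^1$ and $\mathcal{H}^0$ denote the sets of morphisms and objects of a groupoid $\mathcal{H}$. $\overline{\mathbb{N}}^n_{\nearrow}=\{\underline{m}\in\overline{\mathbb{N}}^n:m_1\le m_2\le\dots\le m_n\}$ with the subspace topology. For $\underline{m}\in\overline{\mathbb{N}}^n$ put $m_{n+1}:=+\infty$ and $\varepsilon(\underline{m}):=\min\{i:m_i=+\infty\}\in\{1,\dots,n+1\}$. The equivalence relation $\mathcal{R}_\infty$ on $\overline{\mathbb{N}}^n$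 is: $(\underline{m},\underline{m}')\in\mathcal{R}_\infty$ iff $\varepsilon(\underline{m})=\varepsilon(\underline{m}')=:i_1$ and $m_i=m_i'$ for all $i<i_1$. $[\underline{m}]$ is the class of $\underline{m}$, and $\overline{\mathbb{N}}^n/\mathcal{R}_\infty$ has the quotient topology. For $S=\overline{\mathbb{N}}^n$ or $S=\overline{\mathbb{N}}^n_{\nearrow}$, $\mathbb{Z}\times(\mathbb{Z}^n\ltimes\overline{\mathbb{Z}}^n)|_S$ denotes the product of the group $\mathbb{Z}$ with the reduction to $S$ of the transformation groupoid of $\mathbb{Z}^n$ acting on $\overline{\mathbb{Z}}^n$ by translations: objects are the elements of $S$; morphisms are triples $(k_0,\underline{k},\underline{m})\in\mathbb{Z}\times\mathbb{Z}^n\times S$ with $\underline{k}+\underline{m}\in S$; source $\underline{k}+\underline{m}$, target $\underline{m}$; $(k_0',\underline{k}',\underline{k}+\underline{m})\cdot(k_0,\underline{k},\underline{m})=(k_0+k_0',\underline{k}+\underline{k}',\underline{m})$; $(k_0,\underline{k},\underline{m})^{-1}=(-k_0,-\underline{k},\underline{k}+\underline{m})$; topology: subspace topology of $\mathbb{Z}\times\mathbb{Z}^n\times S$ ($\mathbb{Z}$ discrete). Sheu's groupoid $\mathfrak{F}_n$. Let $\widetilde{\mathfrak{F}}_n$ be the subgroupoid of $\mathbb{Z}\times(\mathbb{Z}^n\ltimes\overline{\mathbb{Z}}^n)|_{\overline{\mathbb{N}}^n}$ with the same objects, whose morphisms $(k_0,\underline{k},\underline{m})$ satisfy: whenever $i_1:=\varepsilon(\underline{m})\le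 n$, one has $\sum_{i=0}^{i_1}k_i=0$ and $k_j=0$ for all $i_1<j\le n$. Write $(k_0,\underline{k},\underline{m})\sim(k_0',\underline{k}',\underline{m}')$ iff $k_0=k_0'$, $\underline{k}=\underline{k}'$ and $(\underline{m},\underline{m}')\in\mathcal{R}_\infty$. $\mathfrak{F}_n$ is the quotient groupoid, with morphisms $\mathfrak{F}_n^1=\widetilde{\mathfrak{F}}_n^1/{\sim}$ (elements written $(k_0,\underline{k},[\underline{m}])$), objects $\mathfrak{F}_n^0=\overline{\mathbb{N}}^n/\mathcal{R}_\infty$, and the structure maps induced by those of $\widetilde{\mathfrak{F}}_n$ (so $(k_0,\underline{k},[\underline{m}])$ has source $[\underline{k}+\underline{m}]$, target $[\underline{m}]$, and $(k_0',\underline{k}',[\underline{k}+\underline{m}])\cdot(k_0,\underline{k},[\underline{m}])=(k_0+k_0',\underline{k}+\underline{k}',[\underline{m}])$). $\mathfrak{F}_n^1$ is a topological subspace of $\mathbb{Z}\times\mathbb{Z}^n\times(\overline{\mathbb{N}}^n/\mathcal{R}_\infty)$. The groupoid $\mathcal{F}$. It is the topological subgroupoid of $\mathbb{Z}\times(\mathbb{Z}^n\ltimes\overline{\mathbb{Z}}^n)|_{\overline{\mathbb{N}}^n_{\nearrow}}$ with the same objects, whose morphisms $(k_0,\underline{k},\underline{m})$ satisfy in addition: if $i_1:=\varepsilon(\underline{m})\le n$, then $k_j=-k_0$ for all $i_1\le j\le n$. *)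

theory Defs
  imports "HOL-Analysis.Analysis"
begin

section \<open>The one-point compactifications of the integers and of the natural numbers\<close>

datatype zbar = Fin int | PInf

instantiation zbar :: infinity
begin
definition infinity_zbar :: zbar where "\<infinity> = PInf"
instance ..
end

instantiation zbar :: comm_monoid_add
begin
definition zero_zbar :: zbar where "0 = Fin 0"
fun plus_zbar :: "zbar \<Rightarrow> zbar \<Rightarrow> zbar" where
  "Fin a + Fin b = Fin (a + b)"
| "PInf + y = PInf"
| "Fin a + PInf = PInf"
instance
proof
  fix a b c :: zbar
  show "a + b + c = a + (b + c)" by (cases a; cases b; cases c) auto
  show "a + b = b + a" by (cases a; cases b) auto
  show "0 + a = a" by (cases a) (auto simp: zero_zbar_def)
qed
end

instantiation zbar :: linorder
begin
fun less_eq_zbar :: "zbar \<Rightarrow> zbar \<Rightarrow> bool" where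
  "Fin a \<le> Fin b \<longleftrightarrow> a \<le> b"
| "x \<le> PInf \<longleftrightarrow> True"
| "PInf \<le> Fin b \<longleftrightarrow> False"
definition less_zbar :: "zbar \<Rightarrow> zbar \<Rightarrow> bool" where
  "x < y \<longleftrightarrow> x \<le> y \<and> \<not> y \<le> (x :: zbar)"
instance
proof
  fix x y z :: zbar
  show "x < y \<longleftrightarrow> x \<le> y \<and> \<not> y \<le> x" by (rule less_zbar_def)
  show "x \<le> x" by (cases x) auto
  show "x \<le> y \<Longrightarrow> y \<le> z \<Longrightarrow> x \<le> z" by (cases x; cases y; cases z) auto
  show "x \<le> y \<Longrightarrow> y \<le> x \<Longrightarrow> x = y" by (cases x; cases y) auto
  show "x \<le> y \<or> y \<le> x" by (cases x; cases y) auto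
qed
end

text \<open>The topology is not the order topology: neighbourhoods of \<open>\<infinity>\<close> contain all but finitely
  many of the negative integers as well.\<close>

instantiation zbar :: topological_space
begin
definition open_zbar :: "zbar set \<Rightarrow> bool" where
  "open U \<longleftrightarrow>
     openin (Alexandroff_compactification (discrete_topology (UNIV :: int set)))
       (case_option PInf Fin -` U)"
instance
proof
  show "open (UNIV :: zbar set)"
    using openin_topspace[of "Alexandroff_compactification (discrete_topology (UNIV :: int set))"]
    by (simp add: open_zbar_def notin_range_Some flip: UNIV_option_conv)
  show "open (S \<inter> T)" if "open S" "open T" for S T :: "zbar set"
    using that by (simp add: open_zbar_def vimage_Int openin_Int)
  show "open (\<Union>K)" if "\<forall>S\<in>K. open S" for K :: "zbar set set"
    using that by (auto simp: open_zbar_def vimage_Union intro!: openin_Union)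
qed
end

lemma open_zbar_iff: "open (U :: zbar set) \<longleftrightarrow> (\<infinity> \<in> U \<longrightarrow> finite (- U))"
proof -
  let ?A = "case_option PInf Fin -` U"
  have *: "Some ` {i. Fin i \<in> U} = ?A - {None}" by (auto simp: image_iff split: option.splits)
  show ?thesis
  proof (cases "PInf \<in> U")
    case False
    then have "?A = Some ` {i. Fin i \<in> U}" using * by (auto split: option.splits)
    then show ?thesis using False
      by (auto simp: open_zbar_def infinity_zbar_def openin_Alexandroff_compactification)
  next
    case True
    have 1: "?A = insert None (Some ` (UNIV - {i. Fin i \<notin> U}))"
    proof (rule set_eqI)
      fix x show "x \<in> ?A \<longleftrightarrow> x \<in> insert None (Some ` (UNIV - {i. Fin i \<notin> U}))"
        using True by (cases x) auto
    qed
    have 2: "?A = insert None (Some ` (UNIV - C)) \<Longrightarrow> C = {i. Fin i \<notin> U}" for C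
      by (auto simp: set_eq_iff image_iff split: option.splits)
    have 3: "- U = Fin ` {i. Fin i \<notin> U}"
      using True by (auto simp: image_iff) (metis zbar.exhaust)
    have 4: "finite (- U) \<longleftrightarrow> finite {i. Fin i \<notin> U}"
      unfolding 3 by (rule finite_image_iff) (auto simp: inj_on_def)
    have 5: "?A \<noteq> Some ` V" for V using True by auto
    have "open U \<longleftrightarrow> (\<exists>C. finite C \<and> ?A = insert None (Some ` (UNIV - C)))"
      unfolding open_zbar_def openin_Alexandroff_compactification using 5
      by (auto simp: compactin_discrete_topology)
    also have "\<dots> \<longleftrightarrow> finite {i. Fin i \<notin> U}" using 1 2 by blast
    finally show ?thesis using True 4 by (simp add: infinity_zbar_def)
  qed
qed

text \<open>\<open>Nbar\<close> is given the subspace topology of \<open>zbar\<close>; the following lemma identifies it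
  with the one-point compactification of the discrete space of natural numbers.\<close>

definition Nbar :: "zbar set" where "Nbar = {0..}"

lemma homeomorphic_map_Nbar:
  "homeomorphic_map (Alexandroff_compactification (discrete_topology (UNIV :: nat set)))
     (top_of_set Nbar) (case_option \<infinity> (\<lambda>i. Fin (int i)))"
proof -
  let ?X = "Alexandroff_compactification (discrete_topology (UNIV :: nat set))"
  let ?h = "case_option \<infinity> (\<lambda>i. Fin (int i)) :: nat option \<Rightarrow> zbar"
  have top: "topspace ?X = UNIV" by (simp flip: UNIV_option_conv)
  have inj: "inj ?h" by (auto simp: inj_def infinity_zbar_def split: option.splits)
  have img: "range ?h = Nbar"
  proof -
    have "x \<in> range ?h" if "x \<in> Nbar" for x
    proof (cases x)
      case (Fin a)
      then have "x = ?h (Some (nat a))" using that by (simp add: Nbar_def zero_zbar_def)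
      then show ?thesis by blast
    next
      case PInf
      then have "x = ?h None" by (simp add: infinity_zbar_def)
      then show ?thesis by blast
    qed
    then show ?thesis by (auto simp: Nbar_def zero_zbar_def infinity_zbar_def split: option.splits)
  qed
  have cont: "continuous_map ?X (top_of_set Nbar) ?h"
  proof -
    have "openin ?X (?h -` U)" if "open U" for U
    proof (cases "\<infinity> \<in> U")
      case False
      then have "?h -` U = Some ` {i. Fin (int i) \<in> U}"
        by (auto simp: image_iff split: option.splits)
      then show ?thesis by simp
    next
      case True
      have "(\<lambda>i. Fin (int i)) ` {i. Fin (int i) \<notin> U} \<subseteq> - U" by auto
      then have "finite ((\<lambda>i. Fin (int i)) ` {i. Fin (int i) \<notin> U})"
        using that True finite_subset by (auto simp: open_zbar_iff)
      then have "finite {i. Fin (int i) \<notin> U}"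
        by (subst (asm) finite_image_iff) (auto simp: inj_on_def)
      moreover have "?h -` U = insert None (Some ` (UNIV - {i. Fin (int i) \<notin> U}))"
      proof (intro set_eqI)
        fix x show "x \<in> ?h -` U \<longleftrightarrow> x \<in> insert None (Some ` (UNIV - {i. Fin (int i) \<notin> U}))"
          using True by (cases x) auto
      qed
      ultimately show ?thesis
        unfolding openin_Alexandroff_compactification
        by (intro disjI2) (auto simp: compactin_discrete_topology)
    qed
    moreover have "{x \<in> topspace ?X. ?h x \<in> U} = ?h -` U" for U
      unfolding top by blast
    ultimately have "continuous_map ?X euclidean ?h"
      by (simp add: continuous_map_def)
    then show ?thesis
      using img by (intro continuous_map_into_subtopology) blast+
  qed
  have "Hausdorff_space (euclidean :: zbar topology)"
    unfolding Hausdorff_space_def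
  proof (intro allI impI)
    fix x y :: zbar
    assume "x \<in> topspace euclidean \<and> y \<in> topspace euclidean \<and> x \<noteq> y"
    then have "x \<noteq> y" by simp
    have "open {a}" "open (- {a})" if "a \<noteq> \<infinity>" for a :: zbar
      using that by (auto simp: open_zbar_iff)
    moreover have "x \<noteq> \<infinity> \<or> y \<noteq> \<infinity>" using \<open>x \<noteq> y\<close> by auto
    ultimately show "\<exists>U V. openin euclidean U \<and> openin euclidean V \<and> x \<in> U \<and> y \<in> V \<and> disjnt U V"
      using \<open>x \<noteq> y\<close> unfolding disjnt_def open_openin[symmetric]
      by (metis ComplI Compl_disjoint inf_commute insertI1 singletonD)
  qed
  then have "Hausdorff_space (top_of_set Nbar)" by (rule Hausdorff_space_subtopology)
  then show ?thesis
    using cont inj img top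
    by (intro continuous_imp_homeomorphic_map) auto
qed


section \<open>Topological groupoids\<close>

record ('o, 'm) groupoid =
  obj_top :: "'o topology"
  mor_top :: "'m topology"
  src :: "'m \<Rightarrow> 'o"
  tgt :: "'m \<Rightarrow> 'o"
  mul :: "'m \<Rightarrow> 'm \<Rightarrow> 'm"
  ginv :: "'m \<Rightarrow> 'm"
  ident :: "'o \<Rightarrow> 'm"

abbreviation Obj :: "('o, 'm) groupoid \<Rightarrow> 'o set" where "Obj G \<equiv> topspace (obj_top G)"
abbreviation Mor :: "('o, 'm) groupoid \<Rightarrow> 'm set" where "Mor G \<equiv> topspace (mor_top G)"

text \<open>The product of \<open>g\<close> and \<open>h\<close> is defined if the target of \<open>g\<close> is the source of \<open>h\<close>.\<close>

definition composable :: "('o, 'm) groupoid \<Rightarrow> ('m \<times> 'm) set" where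
  "composable G = {(g, h). g \<in> Mor G \<and> h \<in> Mor G \<and> tgt G g = src G h}"

definition is_groupoid :: "('o, 'm) groupoid \<Rightarrow> bool" where
  "is_groupoid G \<longleftrightarrow>
     src G \<in> Mor G \<rightarrow> Obj G \<and> tgt G \<in> Mor G \<rightarrow> Obj G \<and>
     ginv G \<in> Mor G \<rightarrow> Mor G \<and> ident G \<in> Obj G \<rightarrow> Mor G \<and>
     (\<forall>(g, h)\<in>composable G.
        mul G g h \<in> Mor G \<and> src G (mul G g h) = src G g \<and> tgt G (mul G g h) = tgt G h) \<and>
     (\<forall>f g h. (f, g) \<in> composable G \<and> (g, h) \<in> composable G \<longrightarrow>
        mul G (mul G f g) h = mul G f (mul G g h)) \<and>
     (\<forall>x\<in>Obj G. src G (ident G x) = x \<and> tgt G (ident G x) = x) \<and>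
     (\<forall>g\<in>Mor G. mul G (ident G (src G g)) g = g \<and> mul G g (ident G (tgt G g)) = g) \<and>
     (\<forall>g\<in>Mor G. src G (ginv G g) = tgt G g \<and> tgt G (ginv G g) = src G g \<and>
        mul G g (ginv G g) = ident G (src G g) \<and> mul G (ginv G g) g = ident G (tgt G g))"

definition topological_groupoid :: "('o, 'm) groupoid \<Rightarrow> bool" where
  "topological_groupoid G \<longleftrightarrow>
     is_groupoid G \<and>
     continuous_map (mor_top G) (obj_top G) (src G) \<and>
     continuous_map (mor_top G) (obj_top G) (tgt G) \<and>
     continuous_map (obj_top G) (mor_top G) (ident G) \<and>
     continuous_map (mor_top G) (mor_top G) (ginv G) \<and>
     continuous_map (subtopology (prod_topology (mor_top G) (mor_top G)) (composable G))
       (mor_top G) (\<lambda>(g, h). mul G g h)"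

text \<open>Bijectivity on objects and on morphisms is part of \<open>homeomorphic_map\<close>.\<close>

definition topological_groupoid_iso ::
    "('o, 'm) groupoid \<Rightarrow> ('p, 'q) groupoid \<Rightarrow> ('o \<Rightarrow> 'p) \<Rightarrow> ('m \<Rightarrow> 'q) \<Rightarrow> bool" where
  "topological_groupoid_iso G H \<phi>0 \<phi>1 \<longleftrightarrow>
     topological_groupoid G \<and> topological_groupoid H \<and>
     homeomorphic_map (obj_top G) (obj_top H) \<phi>0 \<and>
     homeomorphic_map (mor_top G) (mor_top H) \<phi>1 \<and>
     (\<forall>g\<in>Mor G. src H (\<phi>1 g) = \<phi>0 (src G g) \<and> tgt H (\<phi>1 g) = \<phi>0 (tgt G g)) \<and>
     (\<forall>(g, h)\<in>composable G. \<phi>1 (mul G g h) = mul H (\<phi>1 g) (\<phi>1 h)) \<and>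
     (\<forall>x\<in>Obj G. \<phi>1 (ident G x) = ident H (\<phi>0 x)) \<and>
     (\<forall>g\<in>Mor G. \<phi>1 (ginv G g) = ginv H (\<phi>1 g))"

text \<open>The topological subgroupoid with the same objects and with morphisms those in \<open>M\<close>.\<close>

definition wide_subgroupoid :: "('o, 'm) groupoid \<Rightarrow> 'm set \<Rightarrow> ('o, 'm) groupoid" where
  "wide_subgroupoid G M = G\<lparr>mor_top := subtopology (mor_top G) M\<rparr>"


section \<open>Reductions of the transformation groupoid\<close>

text \<open>Vectors of length \<open>n\<close> are extensional functions on \<open>{1..n}\<close>, as in \<open>product_topology\<close>.\<close>

type_synonym 'a vec = "nat \<Rightarrow> 'a"

definition Zvec_top :: "nat \<Rightarrow> int vec topology" where
  "Zvec_top n = product_topology (\<lambda>_. discrete_topology UNIV) {1..n}"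

definition Zbar_vec_top :: "nat \<Rightarrow> zbar vec topology" where
  "Zbar_vec_top n = product_topology (\<lambda>_. euclidean) {1..n}"

definition Nbar_vec :: "nat \<Rightarrow> zbar vec set" where
  "Nbar_vec n = ({1..n} \<rightarrow>\<^sub>E Nbar)"

definition Nbar_incr :: "nat \<Rightarrow> zbar vec set" where
  "Nbar_incr n = {m \<in> Nbar_vec n. \<forall>i\<in>{1..n}. \<forall>j\<in>{1..n}. i \<le> j \<longrightarrow> m i \<le> m j}"

definition vadd :: "nat \<Rightarrow> int vec \<Rightarrow> int vec \<Rightarrow> int vec" where
  "vadd n k l = (\<lambda>i\<in>{1..n}. k i + l i)"

definition vneg :: "nat \<Rightarrow> int vec \<Rightarrow> int vec" where
  "vneg n k = (\<lambda>i\<in>{1..n}. - k i)"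

definition vzero :: "nat \<Rightarrow> int vec" where
  "vzero n = (\<lambda>i\<in>{1..n}. 0)"

definition translate :: "nat \<Rightarrow> int vec \<Rightarrow> zbar vec \<Rightarrow> zbar vec" where
  "translate n k m = (\<lambda>i\<in>{1..n}. Fin (k i) + m i)"

definition transf_groupoid ::
    "nat \<Rightarrow> zbar vec set \<Rightarrow> (zbar vec, int \<times> int vec \<times> zbar vec) groupoid" where
  "transf_groupoid n S =
     \<lparr>obj_top = subtopology (Zbar_vec_top n) S,
      mor_top = subtopology
        (prod_topology (discrete_topology UNIV)
          (prod_topology (Zvec_top n) (subtopology (Zbar_vec_top n) S)))
        {(k0, k, m). translate n k m \<in> S},
      src = (\<lambda>(k0, k, m). translate n k m),
      tgt = (\<lambda>(k0, k, m). m),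
      mul = (\<lambda>(k0', k', m') (k0, k, m). (k0 + k0', vadd n k k', m)),
      ginv = (\<lambda>(k0, k, m). (- k0, vneg n k, translate n k m)),
      ident = (\<lambda>m. (0, vzero n, m))\<rparr>"

text \<open>The index of the first infinite entry, with the convention that entry \<open>n + 1\<close> is infinite.\<close>

definition eps :: "nat \<Rightarrow> zbar vec \<Rightarrow> nat" where
  "eps n m = Min {i \<in> {1..n+1}. i \<le> n \<longrightarrow> m i = \<infinity>}"


section \<open>Sheu's groupoid\<close>

definition R_inf :: "nat \<Rightarrow> (zbar vec \<times> zbar vec) set" where
  "R_inf n = {(m, m'). m \<in> Nbar_vec n \<and> m' \<in> Nbar_vec n \<and> eps n m = eps n m' \<and>
     (\<forall>i. 1 \<le> i \<and> i < eps n m \<longrightarrow> m i = m' i)}"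

lemma equiv_R_inf: "equiv (Nbar_vec n) (R_inf n)"
  by (rule equivI) (auto simp: R_inf_def refl_on_def sym_def trans_def)

abbreviation cls :: "nat \<Rightarrow> zbar vec \<Rightarrow> zbar vec set" where
  "cls n m \<equiv> R_inf n `` {m}"

definition quotient_topology :: "'a topology \<Rightarrow> ('a \<times> 'a) set \<Rightarrow> 'a set topology" where
  "quotient_topology X r = topology (\<lambda>U. U \<subseteq> topspace X // r \<and> openin X (\<Union>U))"

lemma openin_quotient_topology:
  assumes "equiv (topspace X) r"
  shows "openin (quotient_topology X r) U \<longleftrightarrow> U \<subseteq> topspace X // r \<and> openin X (\<Union>U)"
proof -
  have "istopology (\<lambda>U. U \<subseteq> topspace X // r \<and> openin X (\<Union>U))"
    unfolding istopology_def
  proof (intro conjI allI impI)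
    fix S T
    assume "S \<subseteq> topspace X // r \<and> openin X (\<Union>S)" and "T \<subseteq> topspace X // r \<and> openin X (\<Union>T)"
    moreover from this have "\<Union>(S \<inter> T) = \<Union>S \<inter> \<Union>T"
      using quotient_disj[OF assms] by blast
    ultimately show "S \<inter> T \<subseteq> topspace X // r" "openin X (\<Union>(S \<inter> T))" by auto
  next
    fix K
    assume K: "\<forall>U\<in>K. U \<subseteq> topspace X // r \<and> openin X (\<Union>U)"
    then show "\<Union>K \<subseteq> topspace X // r" by blast
    have "\<Union>(\<Union>K) = \<Union>(Union ` K)" by blast
    then show "openin X (\<Union>(\<Union>K))" using K by auto
  qed
  then show ?thesis by (simp add: quotient_topology_def)
qed

lemma quotient_map_quotient_topology:
  assumes "equiv (topspace X) r"
  shows "quotient_map X (quotient_topology X r) (\<lambda>x. r `` {x})"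
proof -
  have top: "topspace (quotient_topology X r) = topspace X // r"
  proof
    show "topspace (quotient_topology X r) \<subseteq> topspace X // r"
      using openin_quotient_topology[OF assms, THEN iffD1, OF openin_topspace] by (rule conjunct1)
    have "openin (quotient_topology X r) (topspace X // r)"
      by (simp add: openin_quotient_topology[OF assms] Union_quotient[OF assms])
    then show "topspace X // r \<subseteq> topspace (quotient_topology X r)" by (rule openin_subset)
  qed
  have "{x \<in> topspace X. r `` {x} \<in> U} = \<Union>U" if "U \<subseteq> topspace X // r" for U
  proof (intro equalityI subsetI)
    fix x assume "x \<in> {x \<in> topspace X. r `` {x} \<in> U}"
    then show "x \<in> \<Union>U" using equiv_class_self[OF assms] by blast
  next
    fix x assume "x \<in> \<Union>U"
    then obtain C where C: "x \<in> C" "C \<in> U" by blast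
    then have "C \<in> topspace X // r" using that by blast
    then obtain a where a: "C = r `` {a}" by (auto simp: quotient_def)
    with C have "(a, x) \<in> r" by simp
    then have "C = r `` {x}" "x \<in> topspace X"
      using a equiv_class_eq[OF assms] assms by (auto simp: equiv_def refl_on_def)
    then show "x \<in> {x \<in> topspace X. r `` {x} \<in> U}" using C by auto
  qed
  then show ?thesis
    unfolding quotient_map_def top
    by (auto simp: openin_quotient_topology[OF assms] quotient_def)
qed

definition sheu_cover :: "nat \<Rightarrow> (zbar vec, int \<times> int vec \<times> zbar vec) groupoid" where
  "sheu_cover n = wide_subgroupoid (transf_groupoid n (Nbar_vec n))
     {(k0, k, m). eps n m \<le> n \<longrightarrow>
        k0 + (\<Sum>i = 1..eps n m. k i) = 0 \<and> (\<forall>j. eps n m < j \<and> j \<le> n \<longrightarrow> k j = 0)}"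

definition sheu_proj :: "nat \<Rightarrow> int \<times> int vec \<times> zbar vec \<Rightarrow> int \<times> int vec \<times> zbar vec set" where
  "sheu_proj n = (\<lambda>(k0, k, m). (k0, k, cls n m))"

text \<open>The class of a morphism \<open>(k0, k, m)\<close> is encoded as the triple consisting of \<open>k0\<close>, \<open>k\<close>
  and the class of \<open>m\<close>.\<close>

definition class_translate :: "nat \<Rightarrow> int vec \<Rightarrow> zbar vec set \<Rightarrow> zbar vec set" where
  "class_translate n k C = R_inf n `` (translate n k ` C)"

definition sheu_groupoid :: "nat \<Rightarrow> (zbar vec set, int \<times> int vec \<times> zbar vec set) groupoid" where
  "sheu_groupoid n =
     (let Q = quotient_topology (subtopology (Zbar_vec_top n) (Nbar_vec n)) (R_inf n) in
     \<lparr>obj_top = Q,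
      mor_top = subtopology
        (prod_topology (discrete_topology UNIV) (prod_topology (Zvec_top n) Q))
        (sheu_proj n ` Mor (sheu_cover n)),
      src = (\<lambda>(k0, k, C). class_translate n k C),
      tgt = (\<lambda>(k0, k, C). C),
      mul = (\<lambda>(k0', k', C') (k0, k, C). (k0 + k0', vadd n k k', C)),
      ginv = (\<lambda>(k0, k, C). (- k0, vneg n k, class_translate n k C)),
      ident = (\<lambda>C. (0, vzero n, C))\<rparr>)"

lemma topspace_Nbar_vec: "topspace (subtopology (Zbar_vec_top n) (Nbar_vec n)) = Nbar_vec n"
  by (auto simp: Zbar_vec_top_def Nbar_vec_def)

lemma eps_props:
  shows "1 \<le> eps n m" and "eps n m \<le> n + 1" and "eps n m \<le> n \<Longrightarrow> m (eps n m) = \<infinity>"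
    and "\<lbrakk>1 \<le> i; i < eps n m\<rbrakk> \<Longrightarrow> m i \<noteq> \<infinity>"
proof -
  let ?S = "{i \<in> {1..n+1}. i \<le> n \<longrightarrow> m i = \<infinity>}"
  have fin: "finite ?S" by simp
  moreover have "n + 1 \<in> ?S" by simp
  ultimately have "Min ?S \<in> ?S" by (intro Min_in) blast+
  then show *: "1 \<le> eps n m" "eps n m \<le> n + 1" "eps n m \<le> n \<Longrightarrow> m (eps n m) = \<infinity>"
    by (auto simp: eps_def)
  show "m i \<noteq> \<infinity>" if "1 \<le> i" "i < eps n m"
  proof
    assume "m i = \<infinity>"
    then have "i \<in> ?S" using that *(2) by auto
    then have "Min ?S \<le> i" by (rule Min_le[OF fin])
    then show False using that by (simp add: eps_def)
  qed
qed

lemma eps_translate: "eps n (translate n k m) = eps n m"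
proof -
  have "Fin a + y = \<infinity> \<longleftrightarrow> y = \<infinity>" for a y by (cases y) (auto simp: infinity_zbar_def)
  then have "{i \<in> {1..n+1}. i \<le> n \<longrightarrow> translate n k m i = \<infinity>} = {i \<in> {1..n+1}. i \<le> n \<longrightarrow> m i = \<infinity>}"
    by (auto simp: translate_def)
  then show ?thesis by (simp add: eps_def)
qed

text \<open>The structure maps of \<open>sheu_groupoid\<close> are those induced by \<open>sheu_cover\<close>; see
  \<open>sheu_proj_compatible\<close> below.\<close>

lemma Mor_sheu_cover:
  "(k0, k, m) \<in> Mor (sheu_cover n) \<longleftrightarrow>
     k \<in> extensional {1..n} \<and> m \<in> Nbar_vec n \<and> translate n k m \<in> Nbar_vec n \<and>
     (eps n m \<le> n \<longrightarrow>
        k0 + (\<Sum>i = 1..eps n m. k i) = 0 \<and> (\<forall>j. eps n m < j \<and> j \<le> n \<longrightarrow> k j = 0))"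
  by (auto simp: sheu_cover_def wide_subgroupoid_def transf_groupoid_def Zvec_top_def
      Zbar_vec_top_def Nbar_vec_def PiE_def)

lemma sheu_cover_simps:
  "src (sheu_cover n) = (\<lambda>(k0, k, m). translate n k m)"
  "tgt (sheu_cover n) = (\<lambda>(k0, k, m). m)"
  "mul (sheu_cover n) = (\<lambda>(k0', k', m') (k0, k, m). (k0 + k0', vadd n k k', m))"
  "ginv (sheu_cover n) = (\<lambda>(k0, k, m). (- k0, vneg n k, translate n k m))"
  "ident (sheu_cover n) = (\<lambda>m. (0, vzero n, m))"
  by (simp_all add: sheu_cover_def wide_subgroupoid_def transf_groupoid_def)

lemma class_translate_cls:
  assumes "(k0, k, m) \<in> Mor (sheu_cover n)"
  shows "class_translate n k (cls n m) = cls n (translate n k m)"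
proof -
  note M = assms[unfolded Mor_sheu_cover]
  have "(translate n k m, translate n k m') \<in> R_inf n" if r: "(m, m') \<in> R_inf n" for m'
  proof -
    have m': "m' \<in> Nbar_vec n" and e: "eps n m = eps n m'"
      and eq: "\<And>i. 1 \<le> i \<Longrightarrow> i < eps n m \<Longrightarrow> m i = m' i"
      using r by (auto simp: R_inf_def)
    have "Fin (k i) + m' i \<in> Nbar" if i: "i \<in> {1..n}" for i
    proof -
      consider "i < eps n m" | "i = eps n m" | "i > eps n m" by linarith
      then show ?thesis
      proof cases
        case 1
        then have "Fin (k i) + m' i = translate n k m i" using i eq by (simp add: translate_def)
        then show ?thesis using M i by (auto simp: Nbar_vec_def)
      next
        case 2
        then have "m' i = PInf" using eps_props(3)[of n m'] i e by (simp add: infinity_zbar_def)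
        then show ?thesis by (simp add: Nbar_def)
      next
        case 3
        then have "k i = 0" using M i by auto
        then show ?thesis using m' i by (auto simp: Nbar_vec_def simp flip: zero_zbar_def)
      qed
    qed
    then have "translate n k m' \<in> Nbar_vec n" by (auto simp: Nbar_vec_def translate_def)
    moreover have "translate n k m i = translate n k m' i" if "1 \<le> i" "i < eps n m" for i
      using eq[OF that] by (simp add: translate_def restrict_def)
    ultimately show ?thesis using M e
      by (auto simp: R_inf_def eps_translate)
  qed
  moreover have "m \<in> cls n m" using M equiv_class_self[OF equiv_R_inf] by blast
  ultimately show ?thesis
    using equiv_R_inf[of n] unfolding class_translate_def equiv_def
    by (auto simp: Image_def dest: transD symD)
qed

lemma sheu_proj_compatible:
  shows "\<And>g. g \<in> Mor (sheu_cover n) \<Longrightarrow>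
            src (sheu_groupoid n) (sheu_proj n g) = cls n (src (sheu_cover n) g)"
    and "\<And>g. tgt (sheu_groupoid n) (sheu_proj n g) = cls n (tgt (sheu_cover n) g)"
    and "\<And>g h. mul (sheu_groupoid n) (sheu_proj n g) (sheu_proj n h)
            = sheu_proj n (mul (sheu_cover n) g h)"
    and "\<And>g. g \<in> Mor (sheu_cover n) \<Longrightarrow>
            ginv (sheu_groupoid n) (sheu_proj n g) = sheu_proj n (ginv (sheu_cover n) g)"
    and "\<And>m. ident (sheu_groupoid n) (cls n m) = sheu_proj n (ident (sheu_cover n) m)"
  by (auto simp: sheu_groupoid_def sheu_proj_def Let_def sheu_cover_simps class_translate_cls)


section \<open>The groupoid \<open>\<F>\<close> and the comparison map\<close>

definition F_groupoid :: "nat \<Rightarrow> (zbar vec, int \<times> int vec \<times> zbar vec) groupoid" where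
  "F_groupoid n = wide_subgroupoid (transf_groupoid n (Nbar_incr n))
     {(k0, k, m). eps n m \<le> n \<longrightarrow> (\<forall>j. eps n m \<le> j \<and> j \<le> n \<longrightarrow> k j = - k0)}"

definition psums :: "nat \<Rightarrow> 'a::comm_monoid_add vec \<Rightarrow> 'a vec" where
  "psums n k = (\<lambda>i\<in>{1..n}. \<Sum>j = 1..i. k j)"

text \<open>\<open>the_elem\<close> picks the common value of \<open>psums n\<close> on a class.\<close>

definition sheu_obj_map :: "nat \<Rightarrow> zbar vec set \<Rightarrow> zbar vec" where
  "sheu_obj_map n C = the_elem (psums n ` C)"

definition sheu_map :: "nat \<Rightarrow> int \<times> int vec \<times> zbar vec set \<Rightarrow> int \<times> int vec \<times> zbar vec" where
  "sheu_map n = (\<lambda>(k0, k, C). (k0, psums n k, the_elem (psums n ` C)))"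

end

theory Submission
  imports Defs
begin

text \<open>
  Partial summation turns a vector of extended natural numbers into an increasing one. The entries of
  the vector can be recovered from the partial sums by taking differences as long as the sums are finite;
  from the first infinite entry on, every partial sum is infinite and all information is lost. This is
  precisely the information that \<open>R_inf\<close> forgets, so partial summation induces a bijection from the
  classes onto the increasing vectors (\<open>psums_eq_iff_R_inf\<close>, \<open>psums_image_Nbar_vec\<close>). It is continuous
  because addition is continuous on \<open>Nbar\<close>, and a continuous bijection from a compact space, here a
  quotient of a product of copies of \<open>Nbar\<close>, to a Hausdorff space is a homeomorphism
  (\<open>homeomorphic_map_sheu_obj_map\<close>).

  On the group components, partial summation is an automorphism of \<open>\<int>\<^sup>n\<close>, and it intertwines the two
  translation actions since it is additive. The conditions cutting out the two sets of
  morphisms correspond: with \<open>e\<close> the index of the first infinite entry, the partial sums of \<open>k\<close> equal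
  \<open>- k0\<close> at \<open>e\<close> and at all later indices iff this holds at \<open>e\<close> and all entries of \<open>k\<close> after \<open>e\<close> vanish
  (\<open>Mor_sheu_cover_iff_F_groupoid\<close>). Hence the map on morphisms is the restriction of a product of
  homeomorphisms to subspaces that it matches.

  It remains to see that both sides are topological groupoids. For \<open>F_groupoid\<close> this is inherited from the
  transformation groupoid, where continuity reduces to continuity of each single translation because the
  group is discrete. For \<open>sheu_groupoid\<close> nothing has to be done on the quotient itself:
  a structure that corresponds under homeomorphisms to a topological groupoid is one
  (\<open>topological_groupoid_iso_transport\<close>).
\<close>

section \<open>Groupoids: wide subgroupoids and transport of structure\<close>

lemma is_groupoid_closed:
  assumes "is_groupoid G"
  shows "ginv G \<in> Mor G \<rightarrow> Mor G" "ident G \<in> Obj G \<rightarrow> Mor G"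
    and "\<And>g h. (g, h) \<in> composable G \<Longrightarrow> mul G g h \<in> Mor G"
  using assms unfolding is_groupoid_def by blast+

lemma composable_wide_subgroupoid:
  "composable (wide_subgroupoid G M) = composable G \<inter> M \<times> M"
  by (auto simp: composable_def wide_subgroupoid_def)

text \<open>The groupoid laws and continuity are inherited by restriction, so closure under the operations
  is all that has to be verified.\<close>

lemma topological_groupoid_wide_subgroupoid:
  assumes G: "topological_groupoid G"
    and mul: "\<And>g h. \<lbrakk>(g, h) \<in> composable G; g \<in> M; h \<in> M\<rbrakk> \<Longrightarrow> mul G g h \<in> M"
    and inv: "\<And>g. \<lbrakk>g \<in> Mor G; g \<in> M\<rbrakk> \<Longrightarrow> ginv G g \<in> M"
    and ident: "\<And>x. x \<in> Obj G \<Longrightarrow> ident G x \<in> M"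
  shows "topological_groupoid (wide_subgroupoid G M)"
proof -
  let ?H = "wide_subgroupoid G M"
  have sel: "obj_top ?H = obj_top G" "mor_top ?H = subtopology (mor_top G) M" "src ?H = src G"
    "tgt ?H = tgt G" "mul ?H = mul G" "ginv ?H = ginv G" "ident ?H = ident G"
    by (simp_all add: wide_subgroupoid_def)
  have gr: "is_groupoid G" using G by (simp add: topological_groupoid_def)
  have "is_groupoid ?H"
    using gr mul inv ident
    unfolding is_groupoid_def composable_wide_subgroupoid sel topspace_subtopology
    by (auto simp: Pi_iff)
  moreover have "continuous_map (subtopology (prod_topology (mor_top G) (mor_top G)) (composable G \<inter> M \<times> M))
      (subtopology (mor_top G) M) (\<lambda>(g, h). mul G g h)"
    unfolding continuous_map_in_subtopology subtopology_subtopology[symmetric]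
    using G mul by (auto simp: topological_groupoid_def intro: continuous_map_from_subtopology)
  then have "continuous_map (subtopology (prod_topology (mor_top ?H) (mor_top ?H)) (composable ?H))
      (mor_top ?H) (\<lambda>(g, h). mul ?H g h)"
    unfolding composable_wide_subgroupoid sel
    by (simp add: subtopology_subtopology Int_ac flip: subtopology_Times)
  ultimately show ?thesis
    using G inv ident unfolding topological_groupoid_def sel
    by (auto simp: continuous_map_in_subtopology intro: continuous_map_from_subtopology)
qed

text \<open>Each law of \<open>H\<close> pulls back to \<open>G\<close> because \<open>\<phi>0\<close> and \<open>\<phi>1\<close> are injective on objects and morphisms,
  and each structure map of \<open>G\<close> is the corresponding map of \<open>H\<close> conjugated by homeomorphisms, hence
  continuous. Closure of \<open>Mor G\<close> and \<open>Obj G\<close> under the structure maps must be assumed: outside of these sets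
  \<open>\<phi>0\<close> and \<open>\<phi>1\<close> carry no information.\<close>

lemma topological_groupoid_iso_transport:
  assumes H: "topological_groupoid H"
    and \<phi>0: "homeomorphic_map (obj_top G) (obj_top H) \<phi>0"
    and \<phi>1: "homeomorphic_map (mor_top G) (mor_top H) \<phi>1"
    and src: "\<And>g. g \<in> Mor G \<Longrightarrow> src G g \<in> Obj G \<and> \<phi>0 (src G g) = src H (\<phi>1 g)"
    and tgt: "\<And>g. g \<in> Mor G \<Longrightarrow> tgt G g \<in> Obj G \<and> \<phi>0 (tgt G g) = tgt H (\<phi>1 g)"
    and mul: "\<And>g h. (g, h) \<in> composable G \<Longrightarrow>
                mul G g h \<in> Mor G \<and> \<phi>1 (mul G g h) = mul H (\<phi>1 g) (\<phi>1 h)"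
    and ident: "\<And>x. x \<in> Obj G \<Longrightarrow> ident G x \<in> Mor G \<and> \<phi>1 (ident G x) = ident H (\<phi>0 x)"
    and inv: "\<And>g. g \<in> Mor G \<Longrightarrow> ginv G g \<in> Mor G \<and> \<phi>1 (ginv G g) = ginv H (\<phi>1 g)"
  shows "topological_groupoid_iso G H \<phi>0 \<phi>1"
proof -
  obtain \<psi>0 where \<psi>0: "homeomorphic_maps (obj_top G) (obj_top H) \<phi>0 \<psi>0"
    using \<phi>0 homeomorphic_map_maps by blast
  obtain \<psi>1 where \<psi>1: "homeomorphic_maps (mor_top G) (mor_top H) \<phi>1 \<psi>1"
    using \<phi>1 homeomorphic_map_maps by blast
  have cont: "continuous_map (obj_top G) (obj_top H) \<phi>0" "continuous_map (obj_top H) (obj_top G) \<psi>0"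
    "continuous_map (mor_top G) (mor_top H) \<phi>1" "continuous_map (mor_top H) (mor_top G) \<psi>1"
    and left: "\<And>x. x \<in> Obj G \<Longrightarrow> \<psi>0 (\<phi>0 x) = x" "\<And>g. g \<in> Mor G \<Longrightarrow> \<psi>1 (\<phi>1 g) = g"
    using \<psi>0 \<psi>1 by (auto simp: homeomorphic_maps_def)
  have Obj: "\<phi>0 x \<in> Obj H" if "x \<in> Obj G" for x
    using cont(1) that by (auto simp: continuous_map_def)
  have Mor: "\<phi>1 g \<in> Mor H" if "g \<in> Mor G" for g
    using cont(3) that by (auto simp: continuous_map_def)
  have comp: "(\<phi>1 g, \<phi>1 h) \<in> composable H" if "(g, h) \<in> composable G" for g h
    using that Mor src tgt unfolding composable_def by (smt (verit) case_prodD case_prodI mem_Collect_eq)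
  have inj0: "x = y" if "\<phi>0 x = \<phi>0 y" "x \<in> Obj G" "y \<in> Obj G" for x y
    using that left(1) by metis
  have inj1: "g = h" if "\<phi>1 g = \<phi>1 h" "g \<in> Mor G" "h \<in> Mor G" for g h
    using that left(2) by metis
  have gr: "is_groupoid H" using H by (simp add: topological_groupoid_def)
  have mulH: "\<And>g h. (g, h) \<in> composable H \<Longrightarrow>
      mul H g h \<in> Mor H \<and> src H (mul H g h) = src H g \<and> tgt H (mul H g h) = tgt H h"
    and assocH: "\<And>f g h. \<lbrakk>(f, g) \<in> composable H; (g, h) \<in> composable H\<rbrakk> \<Longrightarrow>
      mul H (mul H f g) h = mul H f (mul H g h)"
    and identH: "\<And>x. x \<in> Obj H \<Longrightarrow> src H (ident H x) = x \<and> tgt H (ident H x) = x"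
    and unitH: "\<And>g. g \<in> Mor H \<Longrightarrow> mul H (ident H (src H g)) g = g \<and> mul H g (ident H (tgt H g)) = g"
    and invH: "\<And>g. g \<in> Mor H \<Longrightarrow> src H (ginv H g) = tgt H g \<and> tgt H (ginv H g) = src H g \<and>
        mul H g (ginv H g) = ident H (src H g) \<and> mul H (ginv H g) g = ident H (tgt H g)"
    using gr unfolding is_groupoid_def by blast+
  have mulG: "src G (mul G g h) = src G g \<and> tgt G (mul G g h) = tgt G h"
    if gh: "(g, h) \<in> composable G" for g h
  proof -
    have "g \<in> Mor G" "h \<in> Mor G" using gh by (auto simp: composable_def)
    then show ?thesis
      using mul[OF gh] mulH[OF comp[OF gh]] src tgt by (auto intro!: inj0)
  qed
  have assocG: "mul G (mul G f g) h = mul G f (mul G g h)"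
    if fg: "(f, g) \<in> composable G" and gh: "(g, h) \<in> composable G" for f g h
  proof -
    have "(mul G f g, h) \<in> composable G" "(f, mul G g h) \<in> composable G"
      using fg gh mul mulG by (auto simp: composable_def)
    then show ?thesis
      using assocH[OF comp[OF fg] comp[OF gh]] mul fg gh by (auto intro!: inj1)
  qed
  have identG: "src G (ident G x) = x \<and> tgt G (ident G x) = x" if "x \<in> Obj G" for x
    using that identH[OF Obj[OF that]] ident src tgt by (auto intro!: inj0)
  have unitG: "mul G (ident G (src G g)) g = g \<and> mul G g (ident G (tgt G g)) = g"
    if g: "g \<in> Mor G" for g
  proof -
    have "(ident G (src G g), g) \<in> composable G" "(g, ident G (tgt G g)) \<in> composable G"
      using g identG ident src tgt by (auto simp: composable_def)
    then show ?thesis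
      using unitH[OF Mor[OF g]] mul g ident src tgt by (auto intro!: inj1)
  qed
  have invG: "src G (ginv G g) = tgt G g \<and> tgt G (ginv G g) = src G g \<and>
      mul G g (ginv G g) = ident G (src G g) \<and> mul G (ginv G g) g = ident G (tgt G g)"
    if g: "g \<in> Mor G" for g
  proof -
    have *: "src G (ginv G g) = tgt G g \<and> tgt G (ginv G g) = src G g"
      using invH[OF Mor[OF g]] g inv src tgt by (auto intro!: inj0)
    then have "(g, ginv G g) \<in> composable G" "(ginv G g, g) \<in> composable G"
      using g inv by (auto simp: composable_def)
    then show ?thesis
      using * invH[OF Mor[OF g]] mul g inv ident src tgt by (auto intro!: inj1)
  qed
  have "is_groupoid G"
    unfolding is_groupoid_def
    using src tgt inv ident mul mulG assocG identG unitG invG by (auto simp: Pi_iff)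
  moreover have "continuous_map (mor_top G) (obj_top G) (src G)"
  proof (rule continuous_map_eq)
    show "continuous_map (mor_top G) (obj_top G) (\<psi>0 \<circ> (src H \<circ> \<phi>1))"
      using H cont by (meson continuous_map_compose topological_groupoid_def)
  qed (use src left in \<open>metis comp_apply\<close>)
  moreover have "continuous_map (mor_top G) (obj_top G) (tgt G)"
  proof (rule continuous_map_eq)
    show "continuous_map (mor_top G) (obj_top G) (\<psi>0 \<circ> (tgt H \<circ> \<phi>1))"
      using H cont by (meson continuous_map_compose topological_groupoid_def)
  qed (use tgt left in \<open>metis comp_apply\<close>)
  moreover have "continuous_map (obj_top G) (mor_top G) (ident G)"
  proof (rule continuous_map_eq)
    show "continuous_map (obj_top G) (mor_top G) (\<psi>1 \<circ> (ident H \<circ> \<phi>0))"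
      using H cont by (meson continuous_map_compose topological_groupoid_def)
  qed (use ident left in \<open>metis comp_apply\<close>)
  moreover have "continuous_map (mor_top G) (mor_top G) (ginv G)"
  proof (rule continuous_map_eq)
    show "continuous_map (mor_top G) (mor_top G) (\<psi>1 \<circ> (ginv H \<circ> \<phi>1))"
      using H cont by (meson continuous_map_compose topological_groupoid_def)
  qed (use inv left in \<open>metis comp_apply\<close>)
  moreover have "continuous_map (subtopology (prod_topology (mor_top G) (mor_top G)) (composable G))
       (mor_top G) (\<lambda>(g, h). mul G g h)"
  proof (rule continuous_map_eq)
    have "continuous_map (subtopology (prod_topology (mor_top G) (mor_top G)) (composable G))
       (subtopology (prod_topology (mor_top H) (mor_top H)) (composable H)) (\<lambda>(g, h). (\<phi>1 g, \<phi>1 h))"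
      using cont(3) comp
      by (auto simp: continuous_map_in_subtopology continuous_map_prod_top
          intro!: continuous_map_from_subtopology)
    then show "continuous_map (subtopology (prod_topology (mor_top G) (mor_top G)) (composable G))
       (mor_top G) (\<psi>1 \<circ> ((\<lambda>(g, h). mul H g h) \<circ> (\<lambda>(g, h). (\<phi>1 g, \<phi>1 h))))"
      using H cont by (meson continuous_map_compose topological_groupoid_def)
  qed (use mul left in \<open>clarsimp, metis\<close>)
  ultimately have "topological_groupoid G" by (simp add: topological_groupoid_def)
  then show ?thesis
    using H \<phi>0 \<phi>1 src tgt mul ident inv by (auto simp: topological_groupoid_iso_def)
qed

section \<open>Arithmetic and topology of the compactified integers\<close>

lemma add_eq_infinity_iff: "a + b = \<infinity> \<longleftrightarrow> a = \<infinity> \<or> b = (\<infinity> :: zbar)"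
  by (cases a; cases b) (auto simp: infinity_zbar_def)

lemma sum_eq_infinity_iff:
  fixes m :: "'a \<Rightarrow> zbar"
  shows "finite A \<Longrightarrow> sum m A = \<infinity> \<longleftrightarrow> (\<exists>j\<in>A. m j = \<infinity>)"
  by (induction A rule: finite_induct)
    (auto simp: add_eq_infinity_iff, auto simp: zero_zbar_def infinity_zbar_def)

lemma sum_Fin: "(\<Sum>j\<in>A. Fin (k j)) = Fin (\<Sum>j\<in>A. k j)"
  by (induction A rule: infinite_finite_induct) (auto simp: zero_zbar_def)

lemma Fin_add_Fin_add: "Fin a + (Fin b + x) = Fin (a + b) + x"
  by (cases x) auto

lemma zbar_add_left_cancel: "a \<noteq> \<infinity> \<Longrightarrow> a + x = a + y \<longleftrightarrow> x = (y :: zbar)"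
  by (cases a; cases x; cases y) (auto simp: infinity_zbar_def)

lemma le_add_iff_Nbar: "a \<noteq> \<infinity> \<Longrightarrow> a \<le> a + x \<longleftrightarrow> x \<in> Nbar"
  by (cases a; cases x) (auto simp: infinity_zbar_def Nbar_def zero_zbar_def)

lemma le_add_Nbar: "x \<in> Nbar \<Longrightarrow> a \<le> a + x"
  by (cases a; cases x) (auto simp: infinity_zbar_def Nbar_def zero_zbar_def)

text \<open>A substitute for subtraction, which \<open>zbar\<close> does not have.\<close>

lemma le_imp_diff_Nbar: "a \<le> b \<Longrightarrow> \<exists>d\<in>Nbar. a + d = b"
proof (cases a; cases b)
  fix x y assume "a \<le> b" "a = Fin x" "b = Fin y"
  then show ?thesis by (intro bexI[of _ "Fin (y - x)"]) (auto simp: Nbar_def zero_zbar_def)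
qed (auto intro!: bexI[of _ PInf] simp: Nbar_def zero_zbar_def)

lemma zero_in_Nbar: "0 \<in> Nbar"
  by (simp add: Nbar_def)

lemma add_in_Nbar: "\<lbrakk>x \<in> Nbar; y \<in> Nbar\<rbrakk> \<Longrightarrow> x + y \<in> Nbar"
  by (cases x; cases y) (auto simp: Nbar_def zero_zbar_def)

lemma sum_in_Nbar: "(\<And>j. j \<in> A \<Longrightarrow> m j \<in> Nbar) \<Longrightarrow> sum m A \<in> Nbar"
  by (induction A rule: infinite_finite_induct) (auto intro: zero_in_Nbar add_in_Nbar)

lemma continuous_map_translation_zbar: "continuous_map euclidean euclidean (\<lambda>x. Fin a + x)"
proof -
  have "open ((\<lambda>x. Fin a + x) -` U)" if "open U" for U
  proof -
    have "inj (\<lambda>x. Fin a + x)"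
      by (auto simp: inj_def zbar_add_left_cancel infinity_zbar_def)
    then have "finite (- U) \<Longrightarrow> finite ((\<lambda>x. Fin a + x) -` (- U))" by (rule finite_vimageI[rotated])
    then show ?thesis
      using that by (auto simp: open_zbar_iff vimage_Compl add_eq_infinity_iff infinity_zbar_def)
  qed
  then show ?thesis by (simp add: continuous_map_def vimage_def)
qed

text \<open>Addition is not continuous at \<open>(\<infinity>, \<infinity>)\<close> on all of \<open>zbar\<close>, since \<open>i\<close> and \<open>- i\<close> both tend to \<open>\<infinity>\<close> while
  their sum is \<open>0\<close>. On \<open>Nbar\<close> a sum is at least as large as either summand, so it is close to \<open>\<infinity>\<close> as soon
  as one of the summands is.\<close>

lemma continuous_map_add_Nbar:
  assumes f: "continuous_map X (top_of_set Nbar) f" and g: "continuous_map X (top_of_set Nbar) g"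
  shows "continuous_map X (top_of_set Nbar) (\<lambda>x. f x + g x)"
proof -
  have fN: "f x \<in> Nbar" and gN: "g x \<in> Nbar" if "x \<in> topspace X" for x
    using that f g by (auto simp: continuous_map_def)
  have pre: "openin X {x \<in> topspace X. f x \<in> V}" "openin X {x \<in> topspace X. g x \<in> V}" if "open V" for V
    using f g that by (auto simp: continuous_map_in_subtopology intro: openin_continuous_map_preimage)
  have "openin X {x \<in> topspace X. f x + g x \<in> U}" if U: "open U" for U
  proof (subst openin_subopen, intro ballI)
    fix x assume "x \<in> {x \<in> topspace X. f x + g x \<in> U}"
    then have x: "x \<in> topspace X" "f x + g x \<in> U" by auto
    show "\<exists>T. openin X T \<and> x \<in> T \<and> T \<subseteq> {x \<in> topspace X. f x + g x \<in> U}"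
    proof (cases "f x + g x = \<infinity>")
      case False
      \<comment> \<open>A finite sum has finite summands, and finite points are isolated.\<close>
      let ?T = "{y \<in> topspace X. f y \<in> {f x}} \<inter> {y \<in> topspace X. g y \<in> {g x}}"
      have "openin X ?T"
        using False by (intro openin_Int pre) (auto simp: open_zbar_iff add_eq_infinity_iff)
      then show ?thesis using x by (intro exI[of _ ?T]) auto
    next
      case True
      \<comment> \<open>Finitely many points; if one summand avoids them, the sum lies in \<open>U\<close>.\<close>
      define B where "B = {z \<in> Nbar. \<exists>c\<in>- U. z \<le> c}"
      have fin: "finite (- U)" "\<infinity> \<in> U" using U True x by (auto simp: open_zbar_iff)
      have "finite {z \<in> Nbar. z \<le> c}" if c: "c \<in> - U" for c
      proof -
        obtain a where "c = Fin a" using c fin(2) by (cases c) (auto simp: infinity_zbar_def)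
        then have "{z \<in> Nbar. z \<le> c} \<subseteq> Fin ` {0..a}"
        proof (intro subsetI)
          fix z assume "z \<in> {z \<in> Nbar. z \<le> c}"
          then show "z \<in> Fin ` {0..a}"
            using \<open>c = Fin a\<close> by (cases z) (auto simp: Nbar_def zero_zbar_def)
        qed
        then show ?thesis using finite_subset by blast
      qed
      moreover have "B = (\<Union>c\<in>- U. {z \<in> Nbar. z \<le> c})" by (auto simp: B_def)
      ultimately have "finite B" using fin by simp
      moreover have "\<infinity> \<notin> B"
      proof
        assume "\<infinity> \<in> B"
        then obtain c where "c \<notin> U" "\<infinity> \<le> c" by (auto simp: B_def)
        then show False using fin(2) by (cases c) (auto simp: infinity_zbar_def)
      qed
      ultimately have B: "open (- B)" by (simp add: open_zbar_iff)
      have "f y + g y \<in> U" if "y \<in> topspace X" "f y \<notin> B \<or> g y \<notin> B" for y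
        using that fN[of y] gN[of y] le_add_Nbar[of "g y" "f y"] le_add_Nbar[of "f y" "g y"]
        by (auto simp: B_def add.commute)
      moreover have "f x \<notin> B \<or> g x \<notin> B" using True \<open>\<infinity> \<notin> B\<close> by (metis add_eq_infinity_iff)
      ultimately show ?thesis
        using pre[OF B] x
        by (intro exI[of _ "{y \<in> topspace X. f y \<in> - B} \<union> {y \<in> topspace X. g y \<in> - B}"]) auto
    qed
  qed
  then have "continuous_map X euclidean (\<lambda>x. f x + g x)"
    by (simp add: continuous_map_def)
  then show ?thesis
    using fN gN by (simp add: continuous_map_in_subtopology add_in_Nbar)
qed

lemma continuous_map_sum_Nbar:
  assumes "finite A" "\<And>j. j \<in> A \<Longrightarrow> continuous_map X (top_of_set Nbar) (f j)"
  shows "continuous_map X (top_of_set Nbar) (\<lambda>x. \<Sum>j\<in>A. f j x)"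
  using assms
  by (induction A rule: finite_induct) (auto simp: zero_in_Nbar intro: continuous_map_add_Nbar)

text \<open>Both properties are those of the one-point compactification of the discrete natural numbers.\<close>

lemma compact_Hausdorff_Nbar: "compact_space (top_of_set Nbar)" "Hausdorff_space (top_of_set Nbar)"
proof -
  let ?X = "Alexandroff_compactification (discrete_topology (UNIV :: nat set))"
  have *: "?X homeomorphic_space top_of_set Nbar"
    using homeomorphic_map_Nbar by (rule homeomorphic_map_imp_homeomorphic_space)
  show "compact_space (top_of_set Nbar)"
    using homeomorphic_compact_space[OF *] by simp
  show "Hausdorff_space (top_of_set Nbar)"
    using homeomorphic_Hausdorff_space[OF *]
    by (simp add: Hausdorff_space_Alexandroff_compactification locally_compact_space_discrete_topology)
qed

section \<open>Spaces of vectors and the transformation groupoid\<close>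

text \<open>With a discrete first factor, continuity can be tested on the slices, which are open.\<close>

lemma continuous_map_prod_discrete:
  assumes "\<And>a. a \<in> A \<Longrightarrow> continuous_map Y Z (\<lambda>y. f (a, y))"
  shows "continuous_map (prod_topology (discrete_topology A) Y) Z f"
  unfolding continuous_map_def
proof (intro conjI allI impI)
  show "f \<in> topspace (prod_topology (discrete_topology A) Y) \<rightarrow> topspace Z"
    using assms by (auto simp: continuous_map_def)
  fix U assume U: "openin Z U"
  have "openin (prod_topology (discrete_topology A) Y) (\<Union>a\<in>A. {a} \<times> {y \<in> topspace Y. f (a, y) \<in> U})"
    using openin_continuous_map_preimage[OF assms U]
    by (intro openin_Union) (auto simp: openin_prod_Times_iff)
  also have "(\<Union>a\<in>A. {a} \<times> {y \<in> topspace Y. f (a, y) \<in> U}) =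
      {x \<in> topspace (prod_topology (discrete_topology A) Y). f x \<in> U}" by auto
  finally show "openin (prod_topology (discrete_topology A) Y)
      {x \<in> topspace (prod_topology (discrete_topology A) Y). f x \<in> U}" .
qed

text \<open>Any binary operation between discrete spaces is continuous.\<close>

lemma continuous_map_discrete_binary:
  assumes "continuous_map X (discrete_topology A) f" "continuous_map X (discrete_topology B) g"
    and "\<And>a b. \<lbrakk>a \<in> A; b \<in> B\<rbrakk> \<Longrightarrow> h a b \<in> C"
  shows "continuous_map X (discrete_topology C) (\<lambda>x. h (f x) (g x))"
proof -
  have "continuous_map X (discrete_topology (A \<times> B)) (\<lambda>x. (f x, g x))"
    unfolding prod_topology_discrete_topology using assms(1,2) by (rule continuous_map_pairedI)
  moreover have "continuous_map (discrete_topology (A \<times> B)) (discrete_topology C) (\<lambda>(a, b). h a b)"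
    using assms(3) by auto
  ultimately have "continuous_map X (discrete_topology C) ((\<lambda>(a, b). h a b) \<circ> (\<lambda>x. (f x, g x)))"
    by (rule continuous_map_compose)
  then show ?thesis by (simp add: comp_def)
qed

lemma Nbar_vec_topology:
  "subtopology (Zbar_vec_top n) (Nbar_vec n) = product_topology (\<lambda>_. top_of_set Nbar) {1..n}"
  by (simp add: Zbar_vec_top_def Nbar_vec_def subtopology_product_topology)

lemma compact_Hausdorff_Nbar_vec:
  "compact_space (subtopology (Zbar_vec_top n) (Nbar_vec n))"
  "Hausdorff_space (subtopology (Zbar_vec_top n) (Nbar_vec n))"
  by (simp_all add: Nbar_vec_topology compact_space_product_topology Hausdorff_space_product_topology
      compact_Hausdorff_Nbar)

lemma Zvec_top_discrete: "Zvec_top n = discrete_topology ({1..n} \<rightarrow>\<^sub>E UNIV)"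
  unfolding Zvec_top_def
proof (rule sym, subst discrete_topology_unique, intro conjI ballI)
  fix k :: "int vec" assume k: "k \<in> {1..n} \<rightarrow>\<^sub>E UNIV"
  then have "{k} = (\<Pi>\<^sub>E i\<in>{1..n}. {k i})" by (simp add: PiE_iff PiE_singleton)
  also have "openin (product_topology (\<lambda>_. discrete_topology UNIV) {1..n}) \<dots>"
    by (simp add: openin_PiE)
  finally show "openin (product_topology (\<lambda>_. discrete_topology UNIV) {1..n}) {k}" .
qed simp

text \<open>Index sets are written \<open>{1..n}\<close> throughout; without this declaration the simplifier turns them into
  \<open>{Suc 0..n}\<close>, to which the rules about extensional vectors do not apply.\<close>

declare One_nat_def [simp del]

lemma extensional_vec [simp]:
  "vadd n k l \<in> extensional {1..n}" "vneg n k \<in> extensional {1..n}" "vzero n \<in> extensional {1..n}"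
  "translate n k m \<in> extensional {1..n}" "psums n q \<in> extensional {1..n}"
  by (simp_all add: vadd_def vneg_def vzero_def translate_def psums_def)

lemma topspace_vec_top [simp]:
  "topspace (Zvec_top n) = extensional {1..n}" "topspace (Zbar_vec_top n) = extensional {1..n}"
  by (auto simp: Zvec_top_def Zbar_vec_top_def PiE_def)

lemma translate_vzero: "m \<in> extensional {1..n} \<Longrightarrow> translate n (vzero n) m = m"
  by (auto simp: translate_def vzero_def extensional_def restrict_def simp flip: zero_zbar_def)

lemma translate_translate: "translate n k (translate n l m) = translate n (vadd n k l) m"
  by (auto simp: translate_def vadd_def restrict_def Fin_add_Fin_add)

lemma vadd_ac:
  "vadd n (vadd n k l) k' = vadd n k (vadd n l k')"
  "vadd n k l = vadd n l k"
  "vadd n k (vadd n l k') = vadd n l (vadd n k k')"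
  by (auto simp: vadd_def restrict_def)

lemma vadd_vneg: "vadd n k (vneg n k) = vzero n" "vadd n (vneg n k) k = vzero n"
  by (auto simp: vadd_def vneg_def vzero_def restrict_def)

lemma vadd_vzero:
  "k \<in> extensional {1..n} \<Longrightarrow> vadd n k (vzero n) = k"
  "k \<in> extensional {1..n} \<Longrightarrow> vadd n (vzero n) k = k"
  by (auto simp: vadd_def vzero_def restrict_def extensional_def)

lemma continuous_map_translate:
  "continuous_map (Zbar_vec_top n) (Zbar_vec_top n) (translate n k)"
proof -
  have "continuous_map (Zbar_vec_top n) euclidean (\<lambda>m. Fin (k i) + m i)" if i: "i \<in> {1..n}" for i
  proof -
    have "continuous_map (Zbar_vec_top n) euclidean (\<lambda>m. m i)"
      unfolding Zbar_vec_top_def using i by (rule continuous_map_product_projection)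
    from continuous_map_compose[OF this continuous_map_translation_zbar]
    show ?thesis by (simp add: comp_def)
  qed
  then show ?thesis
    unfolding Zbar_vec_top_def
    by (auto simp: continuous_map_componentwise translate_def)
qed

text \<open>The components of the structure maps are coordinates, operations on the discrete groups \<open>\<int>\<close> and
  \<open>\<int>\<^sup>n\<close>, and the action, whose continuity is that of each single translation.\<close>

lemma topological_groupoid_transf_groupoid:
  assumes S: "S \<subseteq> extensional {1..n}"
  shows "topological_groupoid (transf_groupoid n S)"
proof -
  let ?G = "transf_groupoid n S"
  let ?Y = "subtopology (Zbar_vec_top n) S"
  let ?P = "prod_topology (discrete_topology UNIV) (prod_topology (Zvec_top n) ?Y)
      :: (int \<times> int vec \<times> zbar vec) topology"
  let ?A = "{(k0, k, m). translate n k m \<in> S} :: (int \<times> int vec \<times> zbar vec) set"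
  have sel: "obj_top ?G = ?Y" "mor_top ?G = subtopology ?P ?A"
    "src ?G = (\<lambda>(k0, k, m). translate n k m)" "tgt ?G = (\<lambda>(k0, k, m). m)"
    "mul ?G = (\<lambda>(k0', k', m') (k0, k, m). (k0 + k0', vadd n k k', m))"
    "ginv ?G = (\<lambda>(k0, k, m). (- k0, vneg n k, translate n k m))"
    "ident ?G = (\<lambda>m. (0, vzero n, m))"
    by (simp_all add: transf_groupoid_def)
  have ext: "m \<in> extensional {1..n}" if "m \<in> S" for m using S that by blast
  have Obj: "Obj ?G = S" using S by (auto simp: sel)
  have Mor: "Mor ?G = {(k0, k, m). k \<in> extensional {1..n} \<and> m \<in> S \<and> translate n k m \<in> S}"
    using ext by (auto simp: sel)
  have gr: "is_groupoid ?G"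
    unfolding is_groupoid_def composable_def Obj Mor unfolding sel
    by (auto simp del: One_nat_def simp: ext translate_vzero translate_translate vadd_vneg vadd_vzero
        vadd_ac(1)) (auto simp: vadd_ac translate_translate)
  note comp = continuous_map_compose[unfolded comp_def]
  let ?M = "mor_top ?G" and ?Z = "discrete_topology UNIV :: int topology"
  have p: "continuous_map ?P ?Z fst" "continuous_map ?P (Zvec_top n) (\<lambda>x. fst (snd x))"
    "continuous_map ?P ?Y (\<lambda>x. snd (snd x))"
    using continuous_map_fst continuous_map_snd comp[OF continuous_map_snd continuous_map_fst]
      comp[OF continuous_map_snd continuous_map_snd] by blast+
  have q: "continuous_map ?M ?Z fst" "continuous_map ?M (Zvec_top n) (\<lambda>x. fst (snd x))"
    "continuous_map ?M ?Y (\<lambda>x. snd (snd x))"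
    unfolding sel by (intro p continuous_map_from_subtopology)+
  have "continuous_map ?P (Zbar_vec_top n) (\<lambda>x. translate n (fst (snd x)) (snd (snd x)))"
    unfolding Zvec_top_discrete
    by (intro continuous_map_prod_discrete)
      (simp add: continuous_map_translate continuous_map_from_subtopology)
  then have src: "continuous_map ?M ?Y (\<lambda>x. translate n (fst (snd x)) (snd (snd x)))"
    unfolding sel continuous_map_in_subtopology by (auto intro: continuous_map_from_subtopology)
  have neg: "continuous_map ?M ?Z (\<lambda>x. - fst x)"
    by (rule comp[OF q(1)]) simp
  have vneg: "continuous_map ?M (Zvec_top n) (\<lambda>x. vneg n (fst (snd x)))"
    by (rule comp[OF q(2)]) (auto simp: Zvec_top_discrete PiE_def)
  have inv: "continuous_map ?M ?P (ginv ?G)"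
    using neg vneg src unfolding sel(6) case_prod_beta' by (intro continuous_map_pairedI)
  have id: "continuous_map ?Y ?P (ident ?G)"
    unfolding sel(7) by (intro continuous_map_pairedI) simp_all
  let ?C = "subtopology (prod_topology ?M ?M) (composable ?G)"
  have C: "continuous_map ?C ?M fst" "continuous_map ?C ?M snd"
    by (simp_all add: continuous_map_subtopology_fst continuous_map_subtopology_snd)
  have add: "continuous_map ?C ?Z (\<lambda>x. fst (snd x) + fst (fst x))"
    by (rule continuous_map_discrete_binary[OF comp[OF C(2) q(1)] comp[OF C(1) q(1)]]) simp
  have vadd: "continuous_map ?C (Zvec_top n)
      (\<lambda>x. vadd n (fst (snd (snd x))) (fst (snd (fst x))))"
    unfolding Zvec_top_discrete
    by (rule continuous_map_discrete_binary[OF comp[OF C(2) q(2)[unfolded Zvec_top_discrete]]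
          comp[OF C(1) q(2)[unfolded Zvec_top_discrete]]]) (auto simp: PiE_def)
  have mul: "continuous_map ?C ?P (\<lambda>(g, h). mul ?G g h)"
    using add vadd comp[OF C(2) q(3)]
    unfolding sel(5) case_prod_beta' by (intro continuous_map_pairedI)
  note closed = is_groupoid_closed[OF gr]
  have into: "continuous_map W ?M f" if "continuous_map W ?P f" "f \<in> topspace W \<rightarrow> Mor ?G"
    for W :: "'c topology" and f
    using that by (auto simp: sel(2) continuous_map_in_subtopology Pi_iff)
  show ?thesis
    unfolding topological_groupoid_def
  proof (intro conjI gr into)
    show "continuous_map ?M (obj_top ?G) (src ?G)" "continuous_map ?M (obj_top ?G) (tgt ?G)"
      using src q(3) unfolding sel(1,3,4) case_prod_beta' by blast+
    show "continuous_map (obj_top ?G) ?P (ident ?G)" using id unfolding sel(1) .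
    show "continuous_map ?M ?P (ginv ?G)" by (fact inv)
    show "continuous_map ?C ?P (\<lambda>(g, h). mul ?G g h)" by (fact mul)
    show "(\<lambda>(g, h). mul ?G g h) \<in> topspace ?C \<rightarrow> Mor ?G"
      using closed(3) unfolding topspace_subtopology by auto
  qed (use closed in blast)+
qed

section \<open>Partial sums\<close>

text \<open>The preceding entry, with \<open>0\<close> in front of the first. The recursion \<open>l i = prev_entry l i + k i\<close>
  characterises the partial sums \<open>l\<close> of \<open>k\<close> without mentioning differences, so that it serves for integers
  and for extended numbers alike.\<close>

definition prev_entry :: "'a::zero vec \<Rightarrow> nat \<Rightarrow> 'a" where
  "prev_entry l i = (if i = 1 then 0 else l (i - 1))"

lemma psums_step:
  assumes "i \<in> {1..n}"
  shows "psums n k i = prev_entry (psums n k) i + k i"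
proof (cases "i = 1")
  case True
  then show ?thesis using assms by (simp add: psums_def prev_entry_def)
next
  case False
  then obtain j where "i = Suc j" "1 \<le> j" using assms by (cases i) auto
  then show ?thesis using assms by (simp add: psums_def prev_entry_def)
qed

lemma psums_eqI:
  assumes "l \<in> extensional {1..n}" "\<And>i. i \<in> {1..n} \<Longrightarrow> l i = prev_entry l i + k i"
  shows "psums n k = l"
proof (rule extensionalityI)
  show "psums n k \<in> extensional {1..n}" by (simp add: psums_def)
  show "psums n k i = l i" if "i \<in> {1..n}" for i
    using that
  proof (induction i)
    case (Suc i)
    then have "prev_entry (psums n k) (Suc i) = prev_entry l (Suc i)"
      by (cases "i = 0") (auto simp: prev_entry_def)
    then show ?case using psums_step[OF Suc.prems, of k] assms(2)[OF Suc.prems] by simp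
  qed simp
qed (fact assms)

lemma inj_on_psums_int: "inj_on (psums n) ({1..n} \<rightarrow>\<^sub>E (UNIV :: int set))"
proof (rule inj_onI)
  fix k k' :: "int vec"
  assume k: "k \<in> {1..n} \<rightarrow>\<^sub>E UNIV" "k' \<in> {1..n} \<rightarrow>\<^sub>E UNIV" and eq: "psums n k = psums n k'"
  then have "k i = k' i" if "i \<in> {1..n}" for i
    using psums_step[OF that, of k] psums_step[OF that, of k'] by simp
  then show "k = k'" using k by (intro PiE_ext)
qed

lemma bij_betw_psums_int:
  "bij_betw (psums n) ({1..n} \<rightarrow>\<^sub>E (UNIV :: int set)) ({1..n} \<rightarrow>\<^sub>E UNIV)"
proof -
  have "l \<in> psums n ` ({1..n} \<rightarrow>\<^sub>E UNIV)" if "l \<in> {1..n} \<rightarrow>\<^sub>E UNIV" for l :: "int vec"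
  proof (rule image_eqI)
    show "l = psums n (\<lambda>i\<in>{1..n}. l i - prev_entry l i)"
      using that by (intro psums_eqI[symmetric]) (auto simp: PiE_iff)
  qed auto
  moreover have "psums n k \<in> {1..n} \<rightarrow>\<^sub>E UNIV" for k :: "int vec"
    by (simp add: psums_def PiE_iff)
  ultimately have "psums n ` ({1..n} \<rightarrow>\<^sub>E UNIV) = ({1..n} \<rightarrow>\<^sub>E (UNIV :: int set))"
    by (intro equalityI subsetI) (simp_all only: image_iff, metis)
  then show ?thesis by (rule bij_betw_imageI[OF inj_on_psums_int])
qed

text \<open>\<open>\<int>\<^sup>n\<close> is discrete, so bijectivity suffices.\<close>

lemma homeomorphic_map_psums_Zvec: "homeomorphic_map (Zvec_top n) (Zvec_top n) (psums n)"
proof -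
  let ?h = "inv_into ({1..n} \<rightarrow>\<^sub>E UNIV) (psums n) :: int vec \<Rightarrow> int vec"
  note bij = bij_betw_psums_int[of n]
  have "homeomorphic_maps (Zvec_top n) (Zvec_top n) (psums n) ?h"
    unfolding homeomorphic_maps_def Zvec_top_discrete continuous_map_from_discrete_topology
      topspace_discrete_topology
    using bij_betw_imp_funcset[OF bij] bij_betw_imp_funcset[OF bij_betw_inv_into[OF bij]]
      bij_betw_inv_into_left[OF bij] bij_betw_inv_into_right[OF bij] by blast
  then show ?thesis by (rule homeomorphic_maps_imp_map)
qed

lemma psums_vadd: "psums n (vadd n k k') = vadd n (psums n k) (psums n k')"
  by (rule ext) (simp add: psums_def vadd_def restrict_def sum.distrib)

lemma psums_vneg: "psums n (vneg n k) = vneg n (psums n k)"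
  by (rule ext) (simp add: psums_def vneg_def restrict_def sum_negf)

lemma psums_vzero: "psums n (vzero n) = vzero n"
  by (rule ext) (simp add: psums_def vzero_def restrict_def)

lemma psums_translate: "psums n (translate n k m) = translate n (psums n k) (psums n m)"
  by (rule ext) (simp add: psums_def translate_def restrict_def sum.distrib sum_Fin)

lemma eps_le_iff: "i \<in> {1..n} \<Longrightarrow> eps n m \<le> i \<longleftrightarrow> (\<exists>j\<in>{1..i}. m j = \<infinity>)"
  using eps_props(1-3)[of n m] eps_props(4)[of _ n m] by (metis atLeastAtMost_iff linorder_not_le order.trans order_refl)

lemma psums_eq_infinity_iff: "i \<in> {1..n} \<Longrightarrow> psums n m i = \<infinity> \<longleftrightarrow> eps n m \<le> i"
  by (simp add: eps_le_iff) (simp add: psums_def sum_eq_infinity_iff)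

lemma eps_eqI:
  assumes "\<And>i. i \<in> {1..n} \<Longrightarrow> eps n m \<le> i \<longleftrightarrow> eps n m' \<le> i"
  shows "eps n m = eps n m'"
  using assms[of "eps n m"] assms[of "eps n m'"] eps_props(1,2)[of n m] eps_props(1,2)[of n m']
  by fastforce

text \<open>A partial sum is infinite exactly from the first infinite entry on.\<close>

lemma eps_psums: "eps n (psums n m) = eps n m"
proof (rule eps_eqI)
  fix i assume i: "i \<in> {1..n}"
  have "eps n (psums n m) \<le> i \<longleftrightarrow> (\<exists>j\<in>{1..i}. psums n m j = \<infinity>)" using i by (rule eps_le_iff)
  also have "\<dots> \<longleftrightarrow> (\<exists>j\<in>{1..i}. eps n m \<le> j)" using i by (auto simp: psums_eq_infinity_iff)
  also have "\<dots> \<longleftrightarrow> eps n m \<le> i" using i by force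
  finally show "eps n (psums n m) \<le> i \<longleftrightarrow> eps n m \<le> i" .
qed

lemma psums_in_Nbar_incr:
  assumes m: "m \<in> Nbar_vec n"
  shows "psums n m \<in> Nbar_incr n"
proof -
  have mN: "m j \<in> Nbar" if "j \<in> {1..n}" for j using m that by (auto simp: Nbar_vec_def)
  have "psums n m \<in> Nbar_vec n"
    using mN by (auto simp: Nbar_vec_def psums_def intro!: sum_in_Nbar)
  moreover have "psums n m i \<le> psums n m j" if "i \<in> {1..n}" "j \<in> {1..n}" "i \<le> j" for i j
  proof -
    have "{1..j} = {1..i} \<union> {i+1..j}" using that by auto
    then have "(\<Sum>l=1..j. m l) = (\<Sum>l=1..i. m l) + (\<Sum>l=i+1..j. m l)"
      by (simp add: sum.union_disjoint)
    moreover have "(\<Sum>l=i+1..j. m l) \<in> Nbar" using that mN by (intro sum_in_Nbar) auto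
    ultimately show ?thesis using that by (simp add: psums_def le_add_Nbar)
  qed
  ultimately show ?thesis by (simp add: Nbar_incr_def)
qed

lemma prev_entry_le:
  assumes l: "l \<in> Nbar_incr n" and i: "i \<in> {1..n}"
  shows "prev_entry l i \<le> l i"
proof (cases "i = 1")
  case True
  have "l i \<in> Nbar" using l i by (auto simp: Nbar_incr_def Nbar_vec_def)
  then show ?thesis using True by (simp add: prev_entry_def Nbar_def)
next
  case False
  then have "i - 1 \<in> {1..n}" using i by auto
  then show ?thesis using l i False by (auto simp: prev_entry_def Nbar_incr_def)
qed

text \<open>A preimage of an increasing vector is formed by choosing, for each entry, a nonnegative difference to
  the preceding one; where both are infinite the difference is not unique, but any choice will do.\<close>

lemma psums_image_Nbar_vec: "psums n ` Nbar_vec n = Nbar_incr n"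
proof (intro equalityI subsetI)
  fix l assume l: "l \<in> Nbar_incr n"
  then have "\<forall>i\<in>{1..n}. \<exists>d\<in>Nbar. prev_entry l i + d = l i"
    using le_imp_diff_Nbar[OF prev_entry_le] by blast
  then obtain d where d: "\<And>i. i \<in> {1..n} \<Longrightarrow> d i \<in> Nbar \<and> prev_entry l i + d i = l i"
    by metis
  have "psums n (restrict d {1..n}) = l"
    using l d by (intro psums_eqI) (auto simp: Nbar_incr_def Nbar_vec_def PiE_iff)
  moreover have "restrict d {1..n} \<in> Nbar_vec n" using d by (auto simp: Nbar_vec_def)
  ultimately show "l \<in> psums n ` Nbar_vec n" by blast
qed (use psums_in_Nbar_incr in blast)

text \<open>Up to and including the first infinite entry, the sum of the preceding entries is finite and can be
  cancelled.\<close>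

lemma prev_entry_psums_finite:
  assumes "i \<in> {1..n}" "i \<le> eps n m"
  shows "prev_entry (psums n m) i \<noteq> \<infinity>"
proof (cases "i = 1")
  case True
  then show ?thesis by (simp add: prev_entry_def zero_zbar_def infinity_zbar_def)
next
  case False
  then have "i - 1 \<in> {1..n}" using assms by auto
  then show ?thesis
    using assms False psums_eq_infinity_iff[of "i - 1" n m] by (auto simp: prev_entry_def)
qed

text \<open>Partial sums determine the entries before the first infinite one by cancellation; after
  it, all partial sums are infinite whatever the entries are.\<close>

lemma psums_eq_iff_R_inf:
  assumes m: "m \<in> Nbar_vec n" and m': "m' \<in> Nbar_vec n"
  shows "psums n m = psums n m' \<longleftrightarrow> (m, m') \<in> R_inf n"
proof
  assume eq: "psums n m = psums n m'"
  have e: "eps n m = eps n m'" using eps_psums[of n m] eps_psums[of n m'] eq by simp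
  moreover have "m i = m' i" if i: "1 \<le> i" "i < eps n m" for i
  proof -
    have i': "i \<in> {1..n}" using i eps_props(2)[of n m] by auto
    then show ?thesis
      using psums_step[OF i', of m] psums_step[OF i', of m'] eq i
        prev_entry_psums_finite[OF i', of m]
      by (simp add: zbar_add_left_cancel)
  qed
  ultimately show "(m, m') \<in> R_inf n" using m m' by (simp add: R_inf_def)
next
  assume r: "(m, m') \<in> R_inf n"
  show "psums n m = psums n m'"
  proof (rule extensionalityI)
    fix i assume i: "i \<in> {1..n}"
    show "psums n m i = psums n m' i"
    proof (cases "eps n m \<le> i")
      case True
      then show ?thesis using psums_eq_infinity_iff[OF i] r by (metis (mono_tags, lifting) R_inf_def case_prodD mem_Collect_eq)
    next
      case False
      then have "(\<Sum>j=1..i. m j) = (\<Sum>j=1..i. m' j)"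
        using r by (intro sum.cong) (auto simp: R_inf_def)
      then show ?thesis using i by (simp add: psums_def)
    qed
  qed (simp_all add: psums_def)
qed

lemma continuous_map_psums:
  "continuous_map (subtopology (Zbar_vec_top n) (Nbar_vec n))
     (subtopology (Zbar_vec_top n) (Nbar_incr n)) (psums n)"
proof -
  let ?X = "product_topology (\<lambda>_. top_of_set Nbar) {1..n}"
  have "continuous_map ?X (top_of_set Nbar) (\<lambda>m. psums n m i)" if i: "i \<in> {1..n}" for i
  proof -
    have "continuous_map ?X (top_of_set Nbar) (\<lambda>m. \<Sum>j=1..i. m j)"
      using i by (intro continuous_map_sum_Nbar continuous_map_product_projection) auto
    then show ?thesis using i by (simp add: psums_def)
  qed
  then have "continuous_map ?X (subtopology (Zbar_vec_top n) (Nbar_vec n)) (psums n)"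
    unfolding Nbar_vec_topology by (auto simp: continuous_map_componentwise psums_def)
  then have "continuous_map ?X (Zbar_vec_top n) (psums n)"
    by (rule continuous_map_into_fulltopology)
  moreover have "topspace ?X = Nbar_vec n" by (simp add: Nbar_vec_def)
  ultimately show ?thesis
    unfolding Nbar_vec_topology continuous_map_in_subtopology
    using psums_in_Nbar_incr by auto
qed

section \<open>The homeomorphism on objects\<close>

lemma sheu_obj_map_cls:
  assumes m: "m \<in> Nbar_vec n"
  shows "sheu_obj_map n (cls n m) = psums n m"
proof -
  have "psums n m' = psums n m" if "(m, m') \<in> R_inf n" for m'
    using that m by (metis (mono_tags, lifting) R_inf_def case_prodD mem_Collect_eq psums_eq_iff_R_inf)
  moreover have "(m, m) \<in> R_inf n" using m by (simp add: R_inf_def)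
  ultimately have "psums n ` cls n m = {psums n m}" by blast
  then show ?thesis by (simp add: sheu_obj_map_def)
qed

text \<open>A continuous bijection from a compact space to a Hausdorff space; continuity on the quotient
  is continuity of \<open>psums\<close> on representatives.\<close>

lemma homeomorphic_map_sheu_obj_map:
  "homeomorphic_map (quotient_topology (subtopology (Zbar_vec_top n) (Nbar_vec n)) (R_inf n))
     (subtopology (Zbar_vec_top n) (Nbar_incr n)) (sheu_obj_map n)"
proof -
  let ?X = "subtopology (Zbar_vec_top n) (Nbar_vec n)"
  let ?Y = "subtopology (Zbar_vec_top n) (Nbar_incr n)"
  let ?Q = "quotient_topology ?X (R_inf n)"
  have top: "topspace ?X = Nbar_vec n" "topspace ?Y = Nbar_incr n"
    by (auto simp: topspace_Nbar_vec Zbar_vec_top_def Nbar_incr_def Nbar_vec_def)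
  have cls: "quotient_map ?X ?Q (cls n)"
    by (rule quotient_map_quotient_topology) (simp only: topspace_Nbar_vec equiv_R_inf)
  have topQ: "topspace ?Q = cls n ` Nbar_vec n"
    using quotient_imp_surjective_map[OF cls] top by simp
  have Haus: "Hausdorff_space ?Y"
  proof -
    have "?Y = subtopology ?X (Nbar_incr n)"
      by (simp add: subtopology_subtopology Nbar_incr_def Int_absorb1 Collect_restrict)
    then show ?thesis using compact_Hausdorff_Nbar_vec(2) Hausdorff_space_subtopology by metis
  qed
  have "compact_space ?Q"
    using image_compactin[OF _ quotient_imp_continuous_map[OF cls], of "topspace ?X"]
      compact_Hausdorff_Nbar_vec(1)[of n] quotient_imp_surjective_map[OF cls]
    by (simp add: compact_space_def)
  moreover have "continuous_map ?Q ?Y (sheu_obj_map n)"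
  proof -
    have "continuous_map ?X ?Y (sheu_obj_map n \<circ> cls n)"
      using continuous_map_psums by (rule continuous_map_eq) (simp add: top sheu_obj_map_cls)
    then show ?thesis using continuous_compose_quotient_map_eq[OF cls] by blast
  qed
  moreover have "sheu_obj_map n ` topspace ?Q = topspace ?Y"
    using psums_image_Nbar_vec[of n] sheu_obj_map_cls unfolding topQ top image_image by auto
  moreover have "inj_on (sheu_obj_map n) (topspace ?Q)"
    unfolding topQ using equiv_class_eq[OF equiv_R_inf]
    by (auto simp: inj_on_def sheu_obj_map_cls psums_eq_iff_R_inf)
  ultimately show ?thesis using Haus by (intro continuous_imp_homeomorphic_map)
qed

section \<open>The target groupoid\<close>

lemma F_groupoid_simps:
  "obj_top (F_groupoid n) = subtopology (Zbar_vec_top n) (Nbar_incr n)"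
  "src (F_groupoid n) = (\<lambda>(k0, k, m). translate n k m)"
  "tgt (F_groupoid n) = (\<lambda>(k0, k, m). m)"
  "mul (F_groupoid n) = (\<lambda>(k0', k', m') (k0, k, m). (k0 + k0', vadd n k k', m))"
  "ginv (F_groupoid n) = (\<lambda>(k0, k, m). (- k0, vneg n k, translate n k m))"
  "ident (F_groupoid n) = (\<lambda>m. (0, vzero n, m))"
  by (simp_all add: F_groupoid_def wide_subgroupoid_def transf_groupoid_def)

lemma Nbar_incr_extensional: "Nbar_incr n \<subseteq> extensional {1..n}"
  by (auto simp: Nbar_vec_def Nbar_incr_def PiE_iff)

lemma Mor_F_groupoid:
  "(k0, k, m) \<in> Mor (F_groupoid n) \<longleftrightarrow>
     k \<in> extensional {1..n} \<and> m \<in> Nbar_incr n \<and> translate n k m \<in> Nbar_incr n \<and>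
     (eps n m \<le> n \<longrightarrow> (\<forall>j. eps n m \<le> j \<and> j \<le> n \<longrightarrow> k j = - k0))"
  using Nbar_incr_extensional
  by (auto simp: F_groupoid_def wide_subgroupoid_def transf_groupoid_def)

lemma topological_groupoid_F_groupoid: "topological_groupoid (F_groupoid n)"
  unfolding F_groupoid_def
proof (rule topological_groupoid_wide_subgroupoid)
  show "topological_groupoid (transf_groupoid n (Nbar_incr n))"
    using Nbar_incr_extensional by (rule topological_groupoid_transf_groupoid)
qed (use le_trans[OF eps_props(1)[of n]] in
    \<open>auto simp: transf_groupoid_def composable_def eps_translate vadd_def vneg_def vzero_def\<close>)

section \<open>The comparison of morphisms\<close>

lemma topspace_quotient_topology:
  "equiv (topspace X) r \<Longrightarrow> topspace (quotient_topology X r) = (\<lambda>x. r `` {x}) ` topspace X"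
  by (metis quotient_imp_surjective_map quotient_map_quotient_topology)

text \<open>The defining conditions of the two groupoids match under partial summation. For the conditions on
  \<open>k\<close>, the partial sums are constant from an index on iff all later entries of \<open>k\<close> are zero. The condition that
  the translate has nonnegative entries is not equivalent by itself to its counterpart, that the partial sums
  increase, since the latter does not see entries beyond the first infinite one; there it is
  the vanishing of \<open>k\<close> that keeps the translate in \<open>Nbar_vec\<close>.\<close>

lemma Mor_sheu_cover_iff_F_groupoid:
  assumes k: "k \<in> extensional {1..n}" and m: "m \<in> Nbar_vec n"
  shows "(k0, k, m) \<in> Mor (sheu_cover n) \<longleftrightarrow> (k0, psums n k, psums n m) \<in> Mor (F_groupoid n)"
proof -
  let ?e = "eps n m"
  have e: "1 \<le> ?e" by (rule eps_props)
  have cond: "(k0 + (\<Sum>i = 1..?e. k i) = 0 \<and> (\<forall>j. ?e < j \<and> j \<le> n \<longrightarrow> k j = 0)) \<longleftrightarrow>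
      (\<forall>j. ?e \<le> j \<and> j \<le> n \<longrightarrow> psums n k j = - k0)" if en: "?e \<le> n"
  proof (intro iffI conjI allI impI)
    fix j assume L: "k0 + (\<Sum>i = 1..?e. k i) = 0 \<and> (\<forall>j. ?e < j \<and> j \<le> n \<longrightarrow> k j = 0)"
      and j: "?e \<le> j \<and> j \<le> n"
    have "(\<Sum>i = 1..j. k i) = (\<Sum>i = 1..?e. k i)"
      using L j by (intro sum.mono_neutral_right) auto
    then show "psums n k j = - k0" using L j e by (simp add: psums_def)
  next
    assume R: "\<forall>j. ?e \<le> j \<and> j \<le> n \<longrightarrow> psums n k j = - k0"
    then have "psums n k ?e = - k0" using en by blast
    then show "k0 + (\<Sum>i = 1..?e. k i) = 0" using en e by (simp add: psums_def)
    fix j assume j: "?e < j \<and> j \<le> n"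
    then have "?e \<le> j \<and> j \<le> n" "?e \<le> j - 1 \<and> j - 1 \<le> n" by linarith+
    then have "psums n k j = - k0" "psums n k (j - 1) = - k0" using R by blast+
    then show "k j = 0"
      using psums_step[of j n k] j e by (auto simp: prev_entry_def)
  qed
  have tr: "translate n k m \<in> Nbar_vec n"
    if s: "psums n (translate n k m) \<in> Nbar_incr n"
      and zero: "\<And>j. \<lbrakk>?e < j; j \<le> n\<rbrakk> \<Longrightarrow> k j = 0"
  proof -
    have "translate n k m i \<in> Nbar" if i: "i \<in> {1..n}" for i
    proof (cases "i \<le> ?e")
      case True
      then show ?thesis
        using prev_entry_le[OF s i] prev_entry_psums_finite[OF i, of "translate n k m"]
          psums_step[OF i, of "translate n k m"]
        by (simp add: eps_translate le_add_iff_Nbar)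
    next
      case False
      then have "translate n k m i = m i"
        using zero[of i] i by (simp add: translate_def flip: zero_zbar_def)
      then show ?thesis using m i by (auto simp: Nbar_vec_def)
    qed
    then show ?thesis by (auto simp: Nbar_vec_def translate_def)
  qed
  have "psums n (translate n k m) \<in> Nbar_incr n" if "translate n k m \<in> Nbar_vec n"
    using that by (rule psums_in_Nbar_incr)
  moreover have "translate n k m \<in> Nbar_vec n"
    if "psums n (translate n k m) \<in> Nbar_incr n"
      "?e \<le> n \<longrightarrow> (\<forall>j. ?e < j \<and> j \<le> n \<longrightarrow> k j = 0)"
    using that by (intro tr) auto
  ultimately show ?thesis
    unfolding Mor_sheu_cover Mor_F_groupoid eps_psums psums_translate[symmetric]
    using k m psums_in_Nbar_incr[OF m] cond by (metis extensional_vec(5))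
qed

lemma sheu_map_eq: "sheu_map n (k0, k, C) = (k0, psums n k, sheu_obj_map n C)"
  by (simp add: sheu_map_def sheu_obj_map_def)

lemma Obj_sheu_groupoid: "Obj (sheu_groupoid n) = cls n ` Nbar_vec n"
  unfolding sheu_groupoid_def Let_def groupoid.select_convs
  by (subst topspace_quotient_topology) (simp_all only: topspace_Nbar_vec equiv_R_inf)

lemma obj_top_sheu_groupoid:
  "obj_top (sheu_groupoid n) = quotient_topology (subtopology (Zbar_vec_top n) (Nbar_vec n)) (R_inf n)"
  by (simp add: sheu_groupoid_def Let_def)

lemma mor_top_sheu_groupoid:
  "mor_top (sheu_groupoid n) = subtopology
     (prod_topology (discrete_topology UNIV) (prod_topology (Zvec_top n) (obj_top (sheu_groupoid n))))
     (sheu_proj n ` Mor (sheu_cover n))"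
  by (simp add: sheu_groupoid_def Let_def)

lemma mem_Mor_sheu_groupoid:
  "(k0, k, C) \<in> Mor (sheu_groupoid n) \<longleftrightarrow> (\<exists>m. C = cls n m \<and> (k0, k, m) \<in> Mor (sheu_cover n))"
proof -
  have "(k0, k, C) \<in> sheu_proj n ` Mor (sheu_cover n) \<longleftrightarrow>
      (\<exists>m. C = cls n m \<and> (k0, k, m) \<in> Mor (sheu_cover n))"
    by (force simp: sheu_proj_def)
  then show ?thesis
    unfolding mor_top_sheu_groupoid topspace_subtopology topspace_prod_topology Obj_sheu_groupoid
    by (auto simp: Mor_sheu_cover)
qed

text \<open>Although a morphism of the quotient is only required to have some representative in the cover, the
  choice of representative is immaterial: membership in \<open>sheu_cover\<close> depends on \<open>m\<close> through its partial sums
  alone, which are constant on the class.\<close>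

lemma mem_Mor_sheu_groupoid_iff:
  assumes k: "k \<in> extensional {1..n}" and m: "m \<in> Nbar_vec n"
  shows "(k0, k, cls n m) \<in> Mor (sheu_groupoid n) \<longleftrightarrow>
    sheu_map n (k0, k, cls n m) \<in> Mor (F_groupoid n)"
proof -
  have "(k0, k, m') \<in> Mor (sheu_cover n) \<longleftrightarrow> (k0, k, m) \<in> Mor (sheu_cover n)"
    if "cls n m' = cls n m" "m' \<in> Nbar_vec n" for m'
    using that k m sheu_obj_map_cls Mor_sheu_cover_iff_F_groupoid by metis
  then have "(k0, k, cls n m) \<in> Mor (sheu_groupoid n) \<longleftrightarrow> (k0, k, m) \<in> Mor (sheu_cover n)"
    unfolding mem_Mor_sheu_groupoid by (metis Mor_sheu_cover)
  then show ?thesis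
    using k m by (simp only: sheu_map_eq sheu_obj_map_cls Mor_sheu_cover_iff_F_groupoid)
qed

text \<open>The map is a product of three homeomorphisms, restricted to subspaces that correspond to each
  other.\<close>

lemma homeomorphic_map_sheu_map:
  "homeomorphic_map (mor_top (sheu_groupoid n)) (mor_top (F_groupoid n)) (sheu_map n)"
proof -
  let ?Q = "obj_top (sheu_groupoid n)" and ?Y = "obj_top (F_groupoid n)"
  let ?Z = "discrete_topology UNIV :: int topology"
  let ?P = "prod_topology ?Z (prod_topology (Zvec_top n) ?Q)"
  let ?P' = "prod_topology ?Z (prod_topology (Zvec_top n) ?Y)"
  obtain h where h: "homeomorphic_maps (Zvec_top n) (Zvec_top n) (psums n) h"
    using homeomorphic_map_psums_Zvec homeomorphic_map_maps by blast
  obtain g where g: "homeomorphic_maps ?Q ?Y (sheu_obj_map n) g"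
    using homeomorphic_map_sheu_obj_map[of n] homeomorphic_map_maps
    unfolding obj_top_sheu_groupoid F_groupoid_simps by blast
  have "homeomorphic_maps ?P ?P' (\<lambda>(k0, y). (k0, (\<lambda>(k, C). (psums n k, sheu_obj_map n C)) y))
      (\<lambda>(k0, y). (k0, (\<lambda>(k, m). (h k, g m)) y))"
    using h g by (simp add: homeomorphic_maps_prod homeomorphic_maps_id[unfolded id_def])
  moreover have "(\<lambda>(k0, y). (k0, (\<lambda>(k, C). (psums n k, sheu_obj_map n C)) y)) = sheu_map n"
    by (auto simp: sheu_map_eq)
  ultimately have "homeomorphic_map ?P ?P' (sheu_map n)"
    using homeomorphic_maps_imp_map by metis
  moreover define T where "T = {(k0, k, m). translate n k m \<in> Nbar_incr n} \<inter>
    {(k0, k, m). eps n m \<le> n \<longrightarrow> (\<forall>j. eps n m \<le> j \<and> j \<le> n \<longrightarrow> k j = - k0)}"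
  have F: "mor_top (F_groupoid n) = subtopology ?P' T"
    by (simp add: T_def F_groupoid_def wide_subgroupoid_def transf_groupoid_def
        subtopology_subtopology)
  have "sheu_map n x \<in> T \<longleftrightarrow> x \<in> sheu_proj n ` Mor (sheu_cover n)"
    if xP: "x \<in> topspace ?P" and xP': "sheu_map n x \<in> topspace ?P'" for x
  proof -
    obtain k0 k m where x: "x = (k0, k, cls n m)" "k \<in> extensional {1..n}" "m \<in> Nbar_vec n"
      using xP by (auto simp: Obj_sheu_groupoid)
    have "x \<in> sheu_proj n ` Mor (sheu_cover n) \<longleftrightarrow> x \<in> Mor (sheu_groupoid n)"
      using xP by (simp add: mor_top_sheu_groupoid)
    also have "\<dots> \<longleftrightarrow> sheu_map n x \<in> Mor (F_groupoid n)"
      unfolding x(1) using x(2,3) by (rule mem_Mor_sheu_groupoid_iff)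
    also have "\<dots> \<longleftrightarrow> sheu_map n x \<in> T"
      using xP' by (simp add: F)
    finally show ?thesis by simp
  qed
  ultimately show ?thesis
    unfolding F mor_top_sheu_groupoid by (intro homeomorphic_map_subtopologies_alt)
qed

lemma sheu_groupoid_simps:
  "src (sheu_groupoid n) = (\<lambda>(k0, k, C). class_translate n k C)"
  "tgt (sheu_groupoid n) = (\<lambda>(k0, k, C). C)"
  "mul (sheu_groupoid n) = (\<lambda>(k0', k', C') (k0, k, C). (k0 + k0', vadd n k k', C))"
  "ginv (sheu_groupoid n) = (\<lambda>(k0, k, C). (- k0, vneg n k, class_translate n k C))"
  "ident (sheu_groupoid n) = (\<lambda>C. (0, vzero n, C))"
  by (simp_all add: sheu_groupoid_def Let_def)

text \<open>Representatives of two composable morphisms of the quotient need not be composable in the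
  cover. Closure of the morphisms under the operations is therefore deduced from closure on the
  side of \<open>F_groupoid\<close>, where no representatives occur.\<close>

lemma topological_groupoid_iso_sheu_map:
  "topological_groupoid_iso (sheu_groupoid n) (F_groupoid n) (sheu_obj_map n) (sheu_map n)"
proof (rule topological_groupoid_iso_transport)
  let ?G = "sheu_groupoid n" and ?F = "F_groupoid n"
  show "topological_groupoid ?F" by (rule topological_groupoid_F_groupoid)
  then have closed: "ginv ?F \<in> Mor ?F \<rightarrow> Mor ?F" "ident ?F \<in> Obj ?F \<rightarrow> Mor ?F"
    "\<And>g h. (g, h) \<in> composable ?F \<Longrightarrow> mul ?F g h \<in> Mor ?F"
    by (simp_all only: is_groupoid_closed topological_groupoid_def)
  show \<phi>0: "homeomorphic_map (obj_top ?G) (obj_top ?F) (sheu_obj_map n)"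
    unfolding obj_top_sheu_groupoid F_groupoid_simps by (rule homeomorphic_map_sheu_obj_map)
  show \<phi>1: "homeomorphic_map (mor_top ?G) (mor_top ?F) (sheu_map n)"
    by (rule homeomorphic_map_sheu_map)
  have MorF: "sheu_map n g \<in> Mor ?F" if "g \<in> Mor ?G" for g
    using homeomorphic_imp_surjective_map[OF \<phi>1] that by blast
  have rep: "\<exists>k0 k m. g = (k0, k, cls n m) \<and> k \<in> extensional {1..n} \<and> m \<in> Nbar_vec n \<and>
      translate n k m \<in> Nbar_vec n \<and> class_translate n k (cls n m) = cls n (translate n k m)"
    if "g \<in> Mor ?G" for g
  proof -
    obtain k0 k C where "g = (k0, k, C)" by (rule prod_cases3)
    then show ?thesis
      using that class_translate_cls mem_Mor_sheu_groupoid Mor_sheu_cover by metis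
  qed
  show src: "src ?G g \<in> Obj ?G \<and> sheu_obj_map n (src ?G g) = src ?F (sheu_map n g)"
    and tgt: "tgt ?G g \<in> Obj ?G \<and> sheu_obj_map n (tgt ?G g) = tgt ?F (sheu_map n g)"
    if "g \<in> Mor ?G" for g
    using rep[OF that]
    by (auto simp: sheu_groupoid_simps F_groupoid_simps Obj_sheu_groupoid sheu_map_eq
        sheu_obj_map_cls psums_translate)
  show "mul ?G g h \<in> Mor ?G \<and> sheu_map n (mul ?G g h) = mul ?F (sheu_map n g) (sheu_map n h)"
    if gh: "(g, h) \<in> composable ?G" for g h
  proof -
    have g: "g \<in> Mor ?G" and h: "h \<in> Mor ?G" and eq: "tgt ?G g = src ?G h"
      using gh by (auto simp: composable_def)
    have "(sheu_map n g, sheu_map n h) \<in> composable ?F"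
      using MorF[OF g] MorF[OF h] eq tgt[OF g] src[OF h] by (simp add: composable_def)
    then have M: "mul ?F (sheu_map n g) (sheu_map n h) \<in> Mor ?F"
      by (rule closed(3))
    have *: "sheu_map n (mul ?G g h) = mul ?F (sheu_map n g) (sheu_map n h)"
      by (cases g; cases h)
        (simp add: sheu_groupoid_simps F_groupoid_simps sheu_map_eq psums_vadd)
    obtain k0' k' m' k0 k m where gh: "g = (k0', k', cls n m')" "h = (k0, k, cls n m)"
      and m: "m \<in> Nbar_vec n"
      using rep[OF g] rep[OF h] by blast
    have "mul ?G g h = (k0 + k0', vadd n k k', cls n m)"
      by (simp add: gh sheu_groupoid_simps)
    then show ?thesis
      using M * mem_Mor_sheu_groupoid_iff[OF extensional_vec(1) m] by metis
  qed
  show "ident ?G C \<in> Mor ?G \<and> sheu_map n (ident ?G C) = ident ?F (sheu_obj_map n C)"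
    if C: "C \<in> Obj ?G" for C
  proof -
    obtain m where m: "C = cls n m" "m \<in> Nbar_vec n" using C by (auto simp: Obj_sheu_groupoid)
    have "sheu_obj_map n C \<in> Obj ?F"
      using homeomorphic_imp_surjective_map[OF \<phi>0] C by blast
    then have M: "ident ?F (sheu_obj_map n C) \<in> Mor ?F" using closed(2) by blast
    have *: "sheu_map n (ident ?G C) = ident ?F (sheu_obj_map n C)"
      by (simp add: sheu_groupoid_simps F_groupoid_simps sheu_map_eq psums_vzero)
    have "ident ?G C = (0, vzero n, cls n m)" by (simp add: m(1) sheu_groupoid_simps)
    then show ?thesis
      using M * mem_Mor_sheu_groupoid_iff[OF extensional_vec(3) m(2)] by metis
  qed
  show "ginv ?G g \<in> Mor ?G \<and> sheu_map n (ginv ?G g) = ginv ?F (sheu_map n g)"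
    if g: "g \<in> Mor ?G" for g
  proof -
    obtain k0 k m where r: "g = (k0, k, cls n m)" "m \<in> Nbar_vec n"
      "translate n k m \<in> Nbar_vec n" "class_translate n k (cls n m) = cls n (translate n k m)"
      using rep[OF g] by blast
    have M: "ginv ?F (sheu_map n g) \<in> Mor ?F" using closed(1) MorF[OF g] by blast
    have **: "ginv ?G g = (- k0, vneg n k, cls n (translate n k m))"
      by (simp add: r(1,4) sheu_groupoid_simps)
    have *: "sheu_map n (ginv ?G g) = ginv ?F (sheu_map n g)"
      unfolding ** unfolding r(1)
      using r(2,3) by (simp add: F_groupoid_simps sheu_map_eq sheu_obj_map_cls psums_vneg psums_translate)
    show ?thesis
      using M * ** mem_Mor_sheu_groupoid_iff[OF extensional_vec(2) r(3)] by metis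
  qed
qed

theorem proposition6p4:
  fixes n :: nat
  assumes "n \<ge> 1"
  shows "(\<forall>(k0, k, m)\<in>Mor (sheu_cover n).
            sheu_map n (k0, k, cls n m) = (k0, psums n k, psums n m)) \<and>
         (\<forall>m\<in>Nbar_vec n. sheu_obj_map n (cls n m) = psums n m) \<and>
         topological_groupoid_iso (sheu_groupoid n) (F_groupoid n) (sheu_obj_map n) (sheu_map n)"
proof (intro conjI)
  show "\<forall>(k0, k, m)\<in>Mor (sheu_cover n).
      sheu_map n (k0, k, cls n m) = (k0, psums n k, psums n m)"
    by (clarify, simp only: sheu_map_eq sheu_obj_map_cls Mor_sheu_cover)
qed (simp_all add: sheu_obj_map_cls topological_groupoid_iso_sheu_map)

end
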